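(* For any $\mu\in\Lambda^+$ there is a unique $\mathbb{C}$-algebra epimorphism $\Upsilon_{-\mu}\colon Y_{-\mu}(\mathfrak{gl}_n)\twoheadrightarrow Y^{\mathrm{rtt}}_{-\mu}(\mathfrak{gl}_n)$ defined by $E_i(z)\mapsto e_{i,i+1}(z)$, $F_i(z)\mapsto f_{i+1,i}(z)$, $D_j(z)\mapsto g_j(z)$ ($1\le i<n$, $1\le j\le n$).
   Context: Let $n\ge2$, $\Lambda=\bigoplus_{j=1}^n\mathbb{Z}\epsilon_j$, $\epsilon^\vee_j$ the dual basis, $\alpha^\vee_i=\epsilon^\vee_i-\epsilon^\vee_{i+1}$, $\Lambda^+=\{\nu:\alpha^\vee_i(\nu)\ge0\ \forall 1\le i\le n-1\}$. Drinfeld side: for $\nu\in\Lambda$ with $d_j:=\epsilon^\vee_j(\nu)$, $Y_\nu(\mathfrak{gl}_n)$ is the $\mathbb{C}$-algebra generated by $E_i^{(r)},F_i^{(r)}$ ($1\le i<n$, $r\ge1$), $D_i^{(s)}$ ($s\ge d_i$), $\widetilde D_i^{(s)}$ ($s\ge-d_i$) subject to: (Y0) $D_i^{(d_i)}=1$, $\sum_{t=d_i}^{r+d_i}D_i^{(t)}\widetilde D_i^{(r-t)}=-\delta_{r,0}$, $[D_i^{(r)},D_j^{(s)}]=0$; (Y1) $[E_i^{(r)},F_j^{(s)}]=-\delta_{i,j}\sum_{t=-d_i}^{r+s-1-d_{i+1}}\widetilde D_i^{(t)}D_{i+1}^{(r+s-t-1)}$; (Y2) $[D_i^{(r)},E_j^{(s)}]=(\delta_{i,j+1}-\delta_{i,j})\sum_{t=d_i}^{r-1}D_i^{(t)}E_j^{(r+s-t-1)}$;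 (Y3) $[D_i^{(r)},F_j^{(s)}]=(\delta_{i,j}-\delta_{i,j+1})\sum_{t=d_i}^{r-1}F_j^{(r+s-t-1)}D_i^{(t)}$; (Y4) $[E_i^{(r)},E_i^{(s)}]=\sum_{t=1}^{r-1}E_i^{(t)}E_i^{(r+s-t-1)}-\sum_{t=1}^{s-1}E_i^{(t)}E_i^{(r+s-t-1)}$; (Y5) $[F_i^{(r)},F_i^{(s)}]=\sum_{t=1}^{s-1}F_i^{(r+s-t-1)}F_i^{(t)}-\sum_{t=1}^{r-1}F_i^{(r+s-t-1)}F_i^{(t)}$; (Y6) $[E_i^{(r+1)},E_{i+1}^{(s)}]-[E_i^{(r)},E_{i+1}^{(s+1)}]=-E_i^{(r)}E_{i+1}^{(s)}$; (Y7) $[F_i^{(r+1)},F_{i+1}^{(s)}]-[F_i^{(r)},F_{i+1}^{(s+1)}]=F_{i+1}^{(s)}F_i^{(r)}$; (Y8),(Y9) $[E_i^{(r)},E_j^{(s)}]=0=[F_i^{(r)},F_j^{(s)}]$ if $|i-j|>1$; (Y10),(Y11) for $|i-j|=1$: $[E_i^{(r)},[E_i^{(s)},E_j^{(t)}]]+[E_i^{(s)},[E_i^{(r)},E_j^{(t)}]]=0$, and likewise for $F$. Series: $E_i(z)=\sum_{r\ge1}E_i^{(r)}z^{-r}$, $F_i(z)=\sum_{r\ge1}F_i^{(r)}z^{-r}$, $D_i(z)=\sum_{r\ge d_i}D_i^{(r)}z^{-r}$. RTT side: for $\mu\in\Lambda^+$ put $c_i:=\epsilon^\vee_i(\mu)$.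 $Y^{\mathrm{rtt}}_{-\mu}(\mathfrak{gl}_n)$ is the $\mathbb{C}$-algebra generated by $t_{ij}^{(r)}$ ($1\le i,j\le n$, $r\in\mathbb{Z}$), with $T(z)=\sum_{i,j}t_{ij}(z)\otimes E_{ij}$, $t_{ij}(z)=\sum_{r\in\mathbb{Z}}t_{ij}^{(r)}z^{-r}$, subject to: (1) the RTT relation $R(z-w)T_1(z)T_2(w)=T_2(w)T_1(z)R(z-w)$ with $R(z)=z\cdot\mathrm{Id}+P$, $P=\sum_{i,j}E_{ij}\otimes E_{ji}$; (2) the relations expressing that $T(z)$ admits a Gauss decomposition $T(z)=F(z)G(z)E(z)$ with $F(z)=\sum_iE_{ii}+\sum_{i<j}f_{ji}(z)\otimes E_{ji}$, $G(z)=\sum_ig_i(z)\otimes E_{ii}$, $E(z)=\sum_iE_{ii}+\sum_{i<j}e_{ij}(z)\otimes E_{ij}$, where $e_{ij}(z)=\sum_{r\ge1}e^{(r)}_{ij}z^{-r}$, $f_{ji}(z)=\sum_{r\ge1}f^{(r)}_{ji}z^{-r}$, $g_i(z)=z^{c_i}+\sum_{r\ge1-c_i}g^{(r)}_iz^{-r}$ for some elements $e^{(r)}_{ij},f^{(r)}_{ji},g^{(r)}_i$ of the algebra (these are then uniquely determined by $T(z)$). *)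

theory Defs
  imports Complex_Main
begin

definition C_algebra_struct :: "(complex \<Rightarrow> 'a::ring_1) \<Rightarrow> bool" where
  "C_algebra_struct phi \<longleftrightarrow>
     phi 1 = 1 \<and> (\<forall>a b. phi (a + b) = phi a + phi b) \<and>
     (\<forall>a b. phi (a * b) = phi a * phi b) \<and> (\<forall>a x. phi a * x = x * phi a)"

inductive_set C_subalg :: "(complex \<Rightarrow> 'a::ring_1) \<Rightarrow> 'a set \<Rightarrow> 'a set"
  for phi :: "complex \<Rightarrow> 'a" and S :: "'a set" where
  gen: "x \<in> S \<Longrightarrow> x \<in> C_subalg phi S"
| scal: "phi c \<in> C_subalg phi S"
| add: "x \<in> C_subalg phi S \<Longrightarrow> y \<in> C_subalg phi S \<Longrightarrow> x + y \<in> C_subalg phi S"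
| mult: "x \<in> C_subalg phi S \<Longrightarrow> y \<in> C_subalg phi S \<Longrightarrow> x * y \<in> C_subalg phi S"

definition comm :: "'a::ring \<Rightarrow> 'a \<Rightarrow> 'a" where
  "comm x y = x * y - y * x"

definition kd :: "nat \<Rightarrow> nat \<Rightarrow> 'a::ring_1" where
  "kd i j = (if i = j then 1 else 0)"

text \<open>d i = epsilon_i^vee(nu).  E i r, F i r (r \<ge> 1), D i r (r \<ge> d i),
  Dt i r (r \<ge> - d i) are the images of the generators; values outside these
  index ranges are irrelevant.\<close>

definition Y_rels :: "nat \<Rightarrow> (nat \<Rightarrow> int) \<Rightarrow> (nat \<Rightarrow> int \<Rightarrow> 'a::ring_1) \<Rightarrow>
    (nat \<Rightarrow> int \<Rightarrow> 'a) \<Rightarrow> (nat \<Rightarrow> int \<Rightarrow> 'a) \<Rightarrow> (nat \<Rightarrow> int \<Rightarrow> 'a) \<Rightarrow> bool" where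
  "Y_rels n d E F D Dt \<longleftrightarrow>
   \<comment> \<open>(Y0)\<close>
   (\<forall>i\<in>{1..n}. D i (d i) = 1) \<and>
   (\<forall>i\<in>{1..n}. \<forall>r::int. r \<ge> 0 \<longrightarrow>
       (\<Sum>t\<in>{d i..r + d i}. D i t * Dt i (r - t)) = - (if r = 0 then 1 else 0)) \<and>
   (\<forall>i\<in>{1..n}. \<forall>j\<in>{1..n}. \<forall>r s. r \<ge> d i \<longrightarrow> s \<ge> d j \<longrightarrow> comm (D i r) (D j s) = 0) \<and>
   \<comment> \<open>(Y1)\<close>
   (\<forall>i\<in>{1..<n}. \<forall>j\<in>{1..<n}. \<forall>r s. r \<ge> 1 \<longrightarrow> s \<ge> 1 \<longrightarrow>
       comm (E i r) (F j s) =
       - (kd i j * (\<Sum>t\<in>{- d i..r + s - 1 - d (i+1)}. Dt i t * D (i+1) (r + s - t - 1)))) \<and>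
   \<comment> \<open>(Y2)\<close>
   (\<forall>i\<in>{1..n}. \<forall>j\<in>{1..<n}. \<forall>r s. r \<ge> d i \<longrightarrow> s \<ge> 1 \<longrightarrow>
       comm (D i r) (E j s) =
       (kd i (j+1) - kd i j) * (\<Sum>t\<in>{d i..r - 1}. D i t * E j (r + s - t - 1))) \<and>
   \<comment> \<open>(Y3)\<close>
   (\<forall>i\<in>{1..n}. \<forall>j\<in>{1..<n}. \<forall>r s. r \<ge> d i \<longrightarrow> s \<ge> 1 \<longrightarrow>
       comm (D i r) (F j s) =
       (kd i j - kd i (j+1)) * (\<Sum>t\<in>{d i..r - 1}. F j (r + s - t - 1) * D i t)) \<and>
   \<comment> \<open>(Y4)\<close>
   (\<forall>i\<in>{1..<n}. \<forall>r s. r \<ge> 1 \<longrightarrow> s \<ge> 1 \<longrightarrow>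
       comm (E i r) (E i s) =
       (\<Sum>t\<in>{1..r - 1}. E i t * E i (r + s - t - 1)) - (\<Sum>t\<in>{1..s - 1}. E i t * E i (r + s - t - 1))) \<and>
   \<comment> \<open>(Y5)\<close>
   (\<forall>i\<in>{1..<n}. \<forall>r s. r \<ge> 1 \<longrightarrow> s \<ge> 1 \<longrightarrow>
       comm (F i r) (F i s) =
       (\<Sum>t\<in>{1..s - 1}. F i (r + s - t - 1) * F i t) - (\<Sum>t\<in>{1..r - 1}. F i (r + s - t - 1) * F i t)) \<and>
   \<comment> \<open>(Y6)\<close>
   (\<forall>i. 1 \<le> i \<longrightarrow> i + 1 < n \<longrightarrow> (\<forall>r s. r \<ge> 1 \<longrightarrow> s \<ge> 1 \<longrightarrow>
       comm (E i (r+1)) (E (i+1) s) - comm (E i r) (E (i+1) (s+1)) = - (E i r * E (i+1) s))) \<and>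
   \<comment> \<open>(Y7)\<close>
   (\<forall>i. 1 \<le> i \<longrightarrow> i + 1 < n \<longrightarrow> (\<forall>r s. r \<ge> 1 \<longrightarrow> s \<ge> 1 \<longrightarrow>
       comm (F i (r+1)) (F (i+1) s) - comm (F i r) (F (i+1) (s+1)) = F (i+1) s * F i r)) \<and>
   \<comment> \<open>(Y8), (Y9)\<close>
   (\<forall>i\<in>{1..<n}. \<forall>j\<in>{1..<n}. (i + 1 < j \<or> j + 1 < i) \<longrightarrow> (\<forall>r s. r \<ge> 1 \<longrightarrow> s \<ge> 1 \<longrightarrow>
       comm (E i r) (E j s) = 0 \<and> comm (F i r) (F j s) = 0)) \<and>
   \<comment> \<open>(Y10), (Y11)\<close>
   (\<forall>i\<in>{1..<n}. \<forall>j\<in>{1..<n}. (i + 1 = j \<or> j + 1 = i) \<longrightarrow> (\<forall>r s t. r \<ge> 1 \<longrightarrow> s \<ge> 1 \<longrightarrow> t \<ge> 1 \<longrightarrow>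
       comm (E i r) (comm (E i s) (E j t)) + comm (E i s) (comm (E i r) (E j t)) = 0 \<and>
       comm (F i r) (comm (F i s) (F j t)) + comm (F i s) (comm (F i r) (F j t)) = 0))"

text \<open>c i = epsilon_i^vee(mu).  t i j r is the coefficient of z^{-r} in t_ij(z),
  e i j r (i<j, r \<ge> 1), f j i r (j>i, r \<ge> 1), g i r the Gauss coefficients,
  with the series conventions: e, f vanish for r \<le> 0, g_i(z) = z^{c_i} + lower terms.\<close>

definition gauss_F :: "(nat \<Rightarrow> nat \<Rightarrow> int \<Rightarrow> 'a::ring_1) \<Rightarrow> nat \<Rightarrow> nat \<Rightarrow> int \<Rightarrow> 'a" where
  "gauss_F f i k r = (if k = i then (if r = 0 then 1 else 0) else if k < i then f i k r else 0)"

definition gauss_E :: "(nat \<Rightarrow> nat \<Rightarrow> int \<Rightarrow> 'a::ring_1) \<Rightarrow> nat \<Rightarrow> nat \<Rightarrow> int \<Rightarrow> 'a" where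
  "gauss_E e k j r = (if k = j then (if r = 0 then 1 else 0) else if k < j then e k j r else 0)"

definition RTT_rels :: "nat \<Rightarrow> (nat \<Rightarrow> int) \<Rightarrow> (nat \<Rightarrow> nat \<Rightarrow> int \<Rightarrow> 'a::ring_1) \<Rightarrow>
    (nat \<Rightarrow> nat \<Rightarrow> int \<Rightarrow> 'a) \<Rightarrow> (nat \<Rightarrow> nat \<Rightarrow> int \<Rightarrow> 'a) \<Rightarrow> (nat \<Rightarrow> int \<Rightarrow> 'a) \<Rightarrow> bool" where
  "RTT_rels n c t e f g \<longleftrightarrow>
   \<comment> \<open>(1) RTT relation R(z-w)T_1(z)T_2(w) = T_2(w)T_1(z)R(z-w), R(z) = z Id + P, coefficientwise\<close>
   (\<forall>i\<in>{1..n}. \<forall>j\<in>{1..n}. \<forall>k\<in>{1..n}. \<forall>l\<in>{1..n}. \<forall>r s.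
       comm (t i j (r+1)) (t k l s) - comm (t i j r) (t k l (s+1)) =
       t k j s * t i l r - t k j r * t i l s) \<and>
   \<comment> \<open>shape of the Gauss factors\<close>
   (\<forall>i j r. 1 \<le> i \<longrightarrow> i < j \<longrightarrow> j \<le> n \<longrightarrow> r \<le> 0 \<longrightarrow> e i j r = 0 \<and> f j i r = 0) \<and>
   (\<forall>i\<in>{1..n}. g i (- c i) = 1 \<and> (\<forall>r. r < - c i \<longrightarrow> g i r = 0)) \<and>
   \<comment> \<open>(2) T(z) = F(z) G(z) E(z), coefficientwise\<close>
   (\<forall>i\<in>{1..n}. \<forall>j\<in>{1..n}. \<forall>r.
       t i j r = (\<Sum>k\<in>{1..min i j}. \<Sum>a\<in>{0..r + c k}. \<Sum>b\<in>{0..r + c k - a}.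
                    gauss_F f i k a * g k (r - a - b) * gauss_E e k j b))"

end

(*
  Eliminating the first m - 1 indices from T(z) leaves F G E restricted to indices at least m.  This
  Schur complement is the inverse of the lower right block of T(z)^{-1}; since inversion and passage
  to blocks both preserve the RTT relation (inversion up to a sign), each Schur complement satisfies
  it again.  Hence the relations among the Gauss coordinates with indices i, i+1, i+2 can be read
  off near the upper left corner of a Schur complement, while coordinates far apart commute.

  Everything is computed in the ring of iterated Laurent series A((w^{-1}))((z^{-1})), in which
  z - w is a central unit.  The relations involving F are those involving E in the opposite ring,
  with T transposed.  For the Serre relations only the case where one index equals 1 comes from
  the RTT relation; commuting with a coefficient of g raises that index.
*)
theory Submission
  imports Defs "HOL-Computational_Algebra.Formal_Laurent_Series"
begin

unbundle fps_syntax

section \<open>The opposite ring\<close>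

text \<open>A product of a series in z and a series in w has the plain coefficients
  \<open>x $$ r * y $$ s\<close>, without convolution, so the Drinfeld relations are read off from
  coefficients of identities in two variables. The iterated ring is not symmetric in z and w, hence
  each RTT relation is kept in both orders.

  The obstacle is that RTT on one row determines [x(z), y(w)] only up to the one-variable commutator
  K = [x(z), y(z)]: it yields (z - w + 1) N = K, where N = [x(z), y(w)] + (x(z) - x(w))(y(z) -
  y(w))/(z - w). As x and y have no constant term, the support of N forces N = K = 0. This one
  argument gives the quadratic relations and also the antisymmetry behind the Serre relations.

  Inversion turns z - w into w - z, so the argument carries a sign. The inverse matrix returns for
  the Serre relation in which e_{i+1} occurs twice: its last column is explicit once the matrix is
  cut down to indices at most i + 2.\<close>

datatype 'a op = Op (unop: 'a)

instantiation op :: (ring_1) ring_1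
begin
definition "0 = Op 0"
definition "1 = Op 1"
definition "x + y = Op (unop x + unop y)"
definition "x - y = Op (unop x - unop y)"
definition "- x = Op (- unop x)"
definition "x * y = Op (unop y * unop x)"
instance
  by standard
    (simp_all add: zero_op_def one_op_def plus_op_def minus_op_def uminus_op_def times_op_def
      op.expand algebra_simps)
end

lemma Op_simps:
  "Op x + Op y = Op (x + y)" "Op x - Op y = Op (x - y)" "- Op x = Op (- x)"
  "Op x * Op y = Op (y * x)" "0 = Op 0" "1 = Op 1"
  by (simp_all add: zero_op_def one_op_def plus_op_def minus_op_def uminus_op_def times_op_def)

lemma Op_sum: "Op (sum f A) = (\<Sum>i\<in>A. Op (f i))"
  by (induction A rule: infinite_finite_induct) (simp_all add: Op_simps flip: Op_simps(1))

section \<open>Laurent series over a noncommutative ring\<close>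

text \<open>Enlarging the range past the true subdegrees adds only zero terms. The bounds are free
  because the Drinfeld sums start at prescribed exponents.\<close>

lemma fls_mult_nth_bounds:
  fixes f g :: "'a::ring_1 fls"
  assumes f: "\<And>i. i < a \<Longrightarrow> f $$ i = 0" and g: "\<And>i. i < b \<Longrightarrow> g $$ i = 0"
  shows "(f * g) $$ n = (\<Sum>i\<in>{a..n - b}. f $$ i * g $$ (n - i))"
\<comment> \<open>The zero series has subdegree 0 by convention, so for it the bounds say nothing
  about \<open>fls_subdegree\<close>.\<close>
proof (cases "f = 0 \<or> g = 0")
  case True
  then show ?thesis by (elim disjE) simp_all
next
  case False
  then have "f $$ fls_subdegree f \<noteq> 0" "g $$ fls_subdegree g \<noteq> 0"
    by (simp_all add: nth_fls_subdegree_nonzero)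
  then have "a \<le> fls_subdegree f" "b \<le> fls_subdegree g"
    using f g by (meson not_less)+
  then have sub: "{fls_subdegree f..n - fls_subdegree g} \<subseteq> {a..n - b}"
    by simp
  have "f $$ i * g $$ (n - i) = 0" if "i \<notin> {fls_subdegree f..n - fls_subdegree g}" for i
  proof -
    from that consider "i < fls_subdegree f" | "n - i < fls_subdegree g"
      by force
    then show ?thesis
      by cases simp_all
  qed
  then have "(\<Sum>i\<in>{fls_subdegree f..n - fls_subdegree g}. f $$ i * g $$ (n - i)) =
      (\<Sum>i\<in>{a..n - b}. f $$ i * g $$ (n - i))"
    using sub by (intro sum.mono_neutral_left) blast+
  then show ?thesis
    by (simp only: fls_times_nth(2))
qed

lemma fls_mult_nth_bounds2:
  fixes f g :: "'a::ring_1 fls"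
  assumes "\<And>i. i < a \<Longrightarrow> f $$ i = 0" "\<And>i. i < b \<Longrightarrow> g $$ i = 0"
  shows "(f * g) $$ n = (\<Sum>i\<in>{b..n - a}. f $$ (n - i) * g $$ i)"
proof -
  have "(f * g) $$ n = (\<Sum>i\<in>{a..n - b}. f $$ i * g $$ (n - i))"
    using assms by (rule fls_mult_nth_bounds)
  also have "\<dots> = (\<Sum>i\<in>{b..n - a}. f $$ (n - i) * g $$ i)"
    by (rule sum.reindex_bij_witness[of _ "\<lambda>i. n - i" "\<lambda>i. n - i"]) auto
  finally show ?thesis .
qed

text \<open>A leading coefficient 1 inverts on either side, and associativity identifies the two
  one-sided inverses. The support bound later fixes where the series of the D tilde starts.\<close>

lemma fls_unit:
  fixes f :: "'a::ring_1 fls"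
  assumes "f $$ m = 1" and "\<And>i. i < m \<Longrightarrow> f $$ i = 0"
  obtains h where "h * f = 1" "f * h = 1" "\<And>i. i < - m \<Longrightarrow> h $$ i = 0"
proof -
  have m: "fls_subdegree f = m"
    by (rule fls_subdegree_eqI) (simp_all add: assms)
  define l where "l = fls_left_inverse f 1"
  define r where "r = fls_right_inverse f 1"
  have 1: "l * f = 1"
    unfolding l_def by (rule fls_left_inverse) (simp only: m assms mult_1_left)
  have 2: "f * r = 1"
    unfolding r_def by (rule fls_right_inverse) (simp only: m assms mult_1_right)
  have "l * (f * r) = r"
    by (simp only: mult.assoc[symmetric] 1 mult_1_left)
  then have "l = r"
    by (simp only: 2 mult_1_right)
  moreover have "r $$ i = 0" if "i < - m" for i
    using that unfolding r_def m by simp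
  ultimately show ?thesis
    using that 1 2 by blast
qed

lemma Abs_fls_nth_bound:
  assumes "\<And>i. i < a \<Longrightarrow> f i = 0"
  shows "Abs_fls f $$ n = f n"
  using nth_Abs_fls_lower_bound[of a f] assms by simp

text \<open>In \<open>'a fls fls\<close> the outer variable is \<open>z\<^sup>-\<^sup>1\<close> and the inner one \<open>w\<^sup>-\<^sup>1\<close>.\<close>

definition inz :: "'a::ring_1 fls \<Rightarrow> 'a fls fls" where
  "inz f = Abs_fls (\<lambda>r. fls_const (f $$ r))"

abbreviation inw :: "'a::ring_1 fls \<Rightarrow> 'a fls fls" where
  "inw \<equiv> fls_const"

lemma inz_nth [simp]: "inz f $$ r = fls_const (f $$ r)"
  unfolding inz_def by (rule Abs_fls_nth_bound[of "fls_subdegree f"]) simp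

lemma inz_add: "inz (f + g) = inz f + inz g"
  and inz_0 [simp]: "inz 0 = 0"
  and inz_1 [simp]: "inz 1 = 1"
  by (auto intro!: fls_eqI)

lemma inz_sum: "inz (sum f A) = (\<Sum>i\<in>A. inz (f i))"
  by (induction A rule: infinite_finite_induct) (simp_all add: inz_add)

lemma fls_const_sum: "fls_const (sum f A) = (\<Sum>i\<in>A. fls_const (f i))"
  for f :: "'b \<Rightarrow> 'a::ring_1"
  by (induction A rule: infinite_finite_induct) (simp_all flip: fls_plus_const)

lemma inz_mult: "inz (f * g) = inz f * inz g"
proof (rule fls_eqI)
  fix n
  have "(inz f * inz g) $$ n =
      (\<Sum>i\<in>{fls_subdegree f..n - fls_subdegree g}. inz f $$ i * inz g $$ (n - i))"
    by (rule fls_mult_nth_bounds) simp_all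
  also have "\<dots> = inz (f * g) $$ n"
    by (simp add: fls_times_nth(2)[of f g] fls_const_sum)
  finally show "inz (f * g) $$ n = (inz f * inz g) $$ n"
    by simp
qed

lemma inw_mult: "inw (f * g) = inw f * inw g"
  by (simp add: fls_const_mult_const)

section \<open>Coefficients in two variables and the element z - w\<close>

definition cf :: "'a::ring_1 fls fls \<Rightarrow> int \<Rightarrow> int \<Rightarrow> 'a" where
  "cf M r s = M $$ r $$ s"

lemma fls2_eqI: "(\<And>r s. cf M r s = cf N r s) \<Longrightarrow> M = N"
  by (auto simp: cf_def intro!: fls_eqI)

lemma cf_simps [simp]:
  "cf (M + N) r s = cf M r s + cf N r s"
  "cf (M - N) r s = cf M r s - cf N r s"
  "cf (- M) r s = - cf M r s"
  "cf 0 r s = 0"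
  by (simp_all add: cf_def)

lemma cf_inz: "cf (inz f) r s = (if s = 0 then f $$ r else 0)"
  and cf_inw: "cf (inw f) r s = (if r = 0 then f $$ s else 0)"
  by (simp_all add: cf_def)

lemma cf_inz_inw [simp]: "cf (inz f * inw g) r s = f $$ r * g $$ s"
  and cf_inw_inz [simp]: "cf (inw g * inz f) r s = g $$ s * f $$ r"
  by (simp_all add: cf_def)

lemma cf_mult_inw_inw: "cf (inw f * inw g) r s = (if r = 0 then (f * g) $$ s else 0)"
  and cf_mult_inz_inz: "cf (inz f * inz g) r s = (if s = 0 then (f * g) $$ r else 0)"
  by (simp_all flip: inw_mult inz_mult add: cf_inw cf_inz)

text \<open>The variables are inverses of z and w, so the outer \<open>fls_X_inv\<close> is z and
  the inner one is w.\<close>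

definition zw :: "'a::ring_1 fls fls" where
  "zw = fls_X_inv - inw fls_X_inv"

lemma cf_zw: "cf (zw * M) r s = cf M (r + 1) s - cf M r (s + 1)"
  by (simp add: cf_def zw_def algebra_simps fls_X_inv_times_conv_shift)

lemma zw_central: "zw * M = M * zw"
  by (rule fls2_eqI)
    (simp add: cf_def zw_def algebra_simps fls_X_inv_times_conv_shift)

text \<open>In the outer variable z - w starts with z, whose coefficient is 1, so
  \<open>fls_unit\<close> applies at exponent -1. The inverse is the expansion of 1/(z - w) in
  powers of w/z.\<close>

lemma zw_inverse:
  obtains p :: "'a::ring_1 fls fls" where "p * zw = 1" "\<And>x. p * x = x * p"
proof -
  obtain p :: "'a fls fls" where p: "p * zw = 1" "zw * p = 1"
    by (rule fls_unit[of "zw :: 'a fls fls" "-1"])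
      (auto simp: zw_def)
  have "p * x = x * p" for x
  proof -
    have "p * x = p * (x * (zw * p))"
      by (simp add: p)
    also have "\<dots> = p * (zw * x) * p"
      by (simp only: zw_central mult.assoc)
    also have "\<dots> = x * p"
      by (simp only: mult.assoc[symmetric] p mult_1_left)
    finally show ?thesis .
  qed
  then show ?thesis
    using that p by blast
qed

text \<open>A relation \<open>(z - w \<plusminus> 1) N = P(z)\<close> forces \<open>N = 0\<close>: coefficients of \<open>N\<close> vanish
  for large powers of \<open>z\<close>, and the recursion carries this down.\<close>

lemma zw_shift_cancel:
  fixes N :: "'a::ring_1 fls fls"
  assumes low: "\<And>r s. s < 0 \<Longrightarrow> cf N r s = 0"
    and sg: "\<sigma> = 1 \<or> \<sigma> = -1"
    and eq: "\<And>r s. s \<noteq> 0 \<Longrightarrow> cf (zw * N + \<sigma> * N) r s = 0"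
  shows "N = 0"
proof (rule fls2_eqI)
  fix r s :: int
  have sN: "cf (\<sigma> * N) r s = 0" if "cf N r s = 0" for r s
    using sg that by auto
  \<comment> \<open>The exempt exponent s = 0 is reached from s = -1: there the relation ties
    \<open>cf N r 0\<close> to coefficients with negative second index, all zero.\<close>
  have 0: "cf N r 0 = 0" for r
    using eq[of "-1" r] low[of "-1" r] low[of "-1" "r + 1"] sN[of r "-1"] by (simp add: cf_zw)
  have pos: "\<forall>s>0. cf N r s = 0" for r
  proof (cases "r < fls_subdegree N")
    case True
    then show ?thesis by (simp add: cf_def)
  next
    case False
    then have "fls_subdegree N - 1 \<le> r" by simp
    then show ?thesis
    proof (induction r rule: int_ge_induct)
      case base
      then show ?case by (simp add: cf_def)
    next
      case (step r)
      show ?case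
      proof (intro allI impI)
        fix s :: int assume "s > 0"
        then have "cf N r s = 0" "cf N r (s + 1) = 0"
          using step.IH by simp_all
        with \<open>s > 0\<close> show "cf N (r + 1) s = 0"
          using eq[of s r] sN[of r s] by (simp add: cf_zw)
      qed
    qed
  qed
  consider "s < 0" | "s = 0" | "s > 0" by linarith
  then show "cf N r s = cf 0 r s"
    by cases (simp_all add: low 0 pos)
qed

text \<open>Solved for the coefficient with first index r + 1, the equation carries the vanishing
  below the subdegree upwards, for all s at once.\<close>

lemma zw_pm_one_cancel:
  fixes N :: "'a::ring_1 fls fls"
  assumes sg: "\<sigma> = 1 \<or> \<sigma> = -1" and "zw * N + \<sigma> * N = 0"
  shows "N = 0"
proof (rule fls2_eqI)
  have rec: "cf N (r + 1) s = cf N r (s + 1) - cf (\<sigma> * N) r s" for r s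
    using arg_cong[OF assms(2), of "\<lambda>M. cf M r s"] by (simp add: cf_zw algebra_simps)
  have sN: "cf (\<sigma> * N) r s = 0" if "cf N r s = 0" for r s
    using sg that by auto
  fix r s
  have "\<forall>s. cf N r s = 0"
  proof (cases "r < fls_subdegree N")
    case True
    then show ?thesis by (simp add: cf_def)
  next
    case False
    then have "fls_subdegree N - 1 \<le> r" by simp
    then show ?thesis
    proof (induction r rule: int_ge_induct)
      case base
      then show ?case by (simp add: cf_def)
    next
      case (step r)
      then show ?case by (simp add: rec sN)
    qed
  qed
  then show "cf N r s = cf 0 r s"
    by simp
qed

lemma comm_cf:
  assumes "comm (inz f) (inw g) = 0"
  shows "comm (f $$ r) (g $$ s) = 0"
  using arg_cong[OF assms, of "\<lambda>M. cf M r s"] by (simp add: comm_def)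

lemma zw_comm_cf:
  assumes "zw * comm (inz f) (inw g) = M"
  shows "comm (f $$ (r + 1)) (g $$ s) - comm (f $$ r) (g $$ (s + 1)) = cf M r s"
  using arg_cong[OF assms, of "\<lambda>M. cf M r s"] by (simp add: comm_def cf_zw)

section \<open>RTT relations in a ring\<close>

text \<open>\<open>T1\<close>, \<open>T2\<close> and \<open>p\<close> stand for T(z), T(w) and 1/(z
  - w). Left abstract, they cover the exchange of z and w and the sign change under
  inversion.\<close>

definition rtt :: "'b::ring_1 \<Rightarrow> nat set \<Rightarrow> (nat \<Rightarrow> nat \<Rightarrow> 'b) \<Rightarrow> (nat \<Rightarrow> nat \<Rightarrow> 'b) \<Rightarrow> bool" where
  "rtt p I T1 T2 \<longleftrightarrow> (\<forall>i\<in>I. \<forall>j\<in>I. \<forall>k\<in>I. \<forall>l\<in>I.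
     comm (T1 i j) (T2 k l) = p * (T2 k j * T1 i l - T1 k j * T2 i l))"

definition mat_inverse :: "nat set \<Rightarrow> (nat \<Rightarrow> nat \<Rightarrow> 'b::ring_1) \<Rightarrow> (nat \<Rightarrow> nat \<Rightarrow> 'b) \<Rightarrow> bool" where
  "mat_inverse I T S \<longleftrightarrow> (\<forall>i\<in>I. \<forall>j\<in>I.
     (\<Sum>k\<in>I. T i k * S k j) = kd i j \<and> (\<Sum>k\<in>I. S i k * T k j) = kd i j)"

lemma rttD:
  "rtt p I T1 T2 \<Longrightarrow> i \<in> I \<Longrightarrow> j \<in> I \<Longrightarrow> k \<in> I \<Longrightarrow> l \<in> I \<Longrightarrow>
    comm (T1 i j) (T2 k l) = p * (T2 k j * T1 i l - T1 k j * T2 i l)"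
  by (simp add: rtt_def)

lemma rtt_mono: "rtt p I T1 T2 \<Longrightarrow> J \<subseteq> I \<Longrightarrow> rtt p J T1 T2"
  unfolding rtt_def by blast

lemma mat_inverseD:
  assumes "mat_inverse I T S" "i \<in> I" "j \<in> I"
  shows "(\<Sum>k\<in>I. T i k * S k j) = kd i j" "(\<Sum>k\<in>I. S i k * T k j) = kd i j"
  using assms by (simp_all add: mat_inverse_def)

lemma mat_inverse_sym: "mat_inverse I T S \<Longrightarrow> mat_inverse I S T"
  by (simp add: mat_inverse_def)

lemma sum_kd:
  assumes "finite I" "j \<in> I"
  shows "(\<Sum>k\<in>I. f k * kd k j) = f j" "(\<Sum>k\<in>I. f k * kd j k) = f j"
    "(\<Sum>k\<in>I. kd k j * f k) = f j" "(\<Sum>k\<in>I. kd j k * f k) = f j"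
  using assms by (simp_all add: kd_def if_distrib[of "\<lambda>x. _ * x"] if_distrib[of "\<lambda>x. x * _"] cong: if_cong)

lemma double_sum_product:
  fixes c :: "'b::ring_1"
  shows "(\<Sum>u\<in>I. \<Sum>v\<in>J. c * (f u * g v)) = c * ((\<Sum>u\<in>I. f u) * (\<Sum>v\<in>J. g v))"
  by (subst sum_product) (simp only: sum_distrib_left)

lemma comm_uminus [simp]: "comm x (- y) = - comm x y" "comm (- x) y = - comm x y"
  by (simp_all add: comm_def)

lemma comm_0 [simp]: "comm x 0 = 0" "comm 0 x = 0"
  by (simp_all add: comm_def)

lemma comm_1 [simp]: "comm 1 x = 0" "comm x 1 = 0" for x :: "'b::ring_1"
  by (simp_all add: comm_def)

lemma comm_swap: "comm x y = - comm y x"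
  by (simp add: comm_def)

lemma comm_mult: "comm x (y * z) = comm x y * z + y * comm x z"
  and mult_comm: "comm (x * y) z = x * comm y z + comm x z * y"
  by (simp_all add: comm_def algebra_simps)

lemma comm_add: "comm x (y + z) = comm x y + comm x z"
  by (simp_all add: comm_def algebra_simps)

lemma comm_Op: "comm (Op x) (Op y) = Op (comm y x)"
  by (simp add: comm_def Op_simps)

lemma kd_Op: "(kd i j :: 'b::ring_1 op) = Op (kd i j)"
  by (simp add: kd_def Op_simps)

text \<open>The rule for differentiating an inverse, with the derivation \<open>comm x\<close>: T
  and S contract on one side in each of the two terms.\<close>

lemma comm_mat_inverse:
  assumes "finite I" and inv: "mat_inverse I T S" and kl: "k \<in> I" "l \<in> I"
  shows "comm x (S k l) = - (\<Sum>u\<in>I. \<Sum>v\<in>I. S k u * comm x (T u v) * S v l)"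
proof -
  have "(\<Sum>u\<in>I. \<Sum>v\<in>I. S k u * x * T u v * S v l) = (\<Sum>u\<in>I. S k u * x * (\<Sum>v\<in>I. T u v * S v l))"
    by (simp add: sum_distrib_left mult.assoc)
  also have "\<dots> = S k l * x"
    using kl by (simp add: mat_inverseD[OF inv] sum_kd assms(1))
  finally have 1: "(\<Sum>u\<in>I. \<Sum>v\<in>I. S k u * x * T u v * S v l) = S k l * x" .
  have "(\<Sum>u\<in>I. \<Sum>v\<in>I. S k u * T u v * x * S v l) = (\<Sum>v\<in>I. (\<Sum>u\<in>I. S k u * T u v) * (x * S v l))"
    by (subst sum.swap) (simp add: sum_distrib_right mult.assoc)
  also have "\<dots> = x * S k l"
    using kl by (simp add: mat_inverseD[OF inv] sum_kd assms(1))
  finally have 2: "(\<Sum>u\<in>I. \<Sum>v\<in>I. S k u * T u v * x * S v l) = x * S k l" .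
  have "(\<Sum>u\<in>I. \<Sum>v\<in>I. S k u * comm x (T u v) * S v l) = S k l * x - x * S k l"
    unfolding 1[symmetric] 2[symmetric] comm_def
    by (simp add: algebra_simps sum_subtractf)
  then show ?thesis
    by (simp add: comm_def)
qed

lemma comm_mat_inverse_0:
  assumes "finite I" "mat_inverse I T S" "k \<in> I" "l \<in> I"
    and "\<And>u v. u \<in> I \<Longrightarrow> v \<in> I \<Longrightarrow> comm x (T u v) = 0"
  shows "comm x (S k l) = 0"
  using comm_mat_inverse[OF assms(1-4), of x] assms(5) by simp

lemma comm_unit_0:
  fixes x :: "'b::ring_1"
  assumes "comm x y = 0" "h * y = 1" "y * h = 1"
  shows "comm x h = 0"
proof -
  have "x * h = (h * y) * (x * h)" by (simp add: assms)
  also have "\<dots> = h * (x * y) * h" using assms(1) by (simp add: comm_def mult.assoc)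
  also have "\<dots> = h * x" by (simp add: assms mult.assoc)
  finally show ?thesis by (simp add: comm_def)
qed

lemma comm_left_unit_0:
  fixes x :: "'b::ring_1"
  assumes "comm x a = 0" "comm x (a * y) = 0" "h * a = 1"
  shows "comm x y = 0"
proof -
  have "(h * a) * comm x y = 0"
    using assms(1,2) by (simp add: comm_mult mult.assoc)
  then show ?thesis by (simp add: assms(3))
qed

lemma comm_right_unit_0:
  fixes x :: "'b::ring_1"
  assumes "comm x a = 0" "comm x (y * a) = 0" "a * h = 1"
  shows "comm x y = 0"
proof -
  have "comm x y * (a * h) = 0"
    using assms(1,2) by (simp add: comm_mult flip: mult.assoc)
  then show ?thesis by (simp add: assms(3))
qed

locale central =
  fixes p :: "'b::ring_1"
  assumes central: "\<And>x. p * x = x * p"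
begin

lemma central_left: "x * (p * y) = p * (x * y)"
  by (metis central mult.assoc)

text \<open>Once RTT is inserted, \<open>S2\<close> meets \<open>T2\<close> in each of the two sums
  and contracts to a Kronecker delta. Entries whose index pairs give i \<noteq> l and j \<noteq> k
  therefore commute.\<close>

lemma rtt_comm_inverse:
  assumes "finite I" and rtt: "rtt p I T1 T2" and inv: "mat_inverse I T2 S2"
    and I: "i \<in> I" "j \<in> I" "k \<in> I" "l \<in> I"
  shows "comm (T1 i j) (S2 k l) =
    p * (kd i l * (\<Sum>b\<in>I. S2 k b * T1 b j) - kd j k * (\<Sum>a\<in>I. T1 i a * S2 a l))"
proof -
  have A: "(\<Sum>u\<in>I. \<Sum>v\<in>I. S2 k u * T2 u j * (T1 i v * S2 v l)) = kd k j * (\<Sum>a\<in>I. T1 i a * S2 a l)"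
    using I by (simp add: mat_inverseD[OF inv] flip: sum_distrib_left sum_distrib_right)
  have B: "(\<Sum>u\<in>I. \<Sum>v\<in>I. S2 k u * T1 u j * (T2 i v * S2 v l)) = kd i l * (\<Sum>b\<in>I. S2 k b * T1 b j)"
    using I by (simp add: mat_inverseD[OF inv] kd_def flip: sum_distrib_left sum_distrib_right)
  have "comm (T1 i j) (S2 k l) = - (\<Sum>u\<in>I. \<Sum>v\<in>I. S2 k u * comm (T1 i j) (T2 u v) * S2 v l)"
    using I by (intro comm_mat_inverse[OF assms(1) inv])
  also have "\<dots> = - (\<Sum>u\<in>I. \<Sum>v\<in>I. p * (S2 k u * T2 u j * (T1 i v * S2 v l)) -
      p * (S2 k u * T1 u j * (T2 i v * S2 v l)))"
    using I by (simp add: rttD[OF rtt] algebra_simps central_left cong: sum.cong)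
  also have "\<dots> = p * (kd i l * (\<Sum>b\<in>I. S2 k b * T1 b j) - kd j k * (\<Sum>a\<in>I. T1 i a * S2 a l))"
    unfolding sum_subtractf A[symmetric] B[symmetric] kd_def[of j k]
    using A by (simp add: algebra_simps kd_def[of k j] eq_commute[of k j] flip: sum_distrib_left)
  finally show ?thesis .
qed

text \<open>The matrices are inverted one variable at a time: the mixed relation for
  \<open>S2\<close> goes through \<open>comm_mat_inverse\<close> for \<open>T1\<close>. The two
  series end up exchanged with the same \<open>p\<close>, which is the passage from z - w to w -
  z.\<close>

lemma rtt_inverse:
  assumes "finite I" and rtt: "rtt p I T1 T2"
    and inv1: "mat_inverse I T1 S1" and inv2: "mat_inverse I T2 S2"
  shows "rtt p I S2 S1"
  unfolding rtt_def
proof (intro ballI)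
  fix i j k l assume I: "i \<in> I" "j \<in> I" "k \<in> I" "l \<in> I"
  have 1: "(\<Sum>v\<in>I. (\<Sum>b\<in>I. S2 i b * T1 b v) * S1 v l) = S2 i l"
  proof -
    have "(\<Sum>v\<in>I. (\<Sum>b\<in>I. S2 i b * T1 b v) * S1 v l) =
        (\<Sum>b\<in>I. S2 i b * (\<Sum>v\<in>I. T1 b v * S1 v l))"
      by (simp add: sum_distrib_left sum_distrib_right mult.assoc) (rule sum.swap)
    then show ?thesis
      using I by (simp add: mat_inverseD[OF inv1] sum_kd assms(1))
  qed
  have 2: "(\<Sum>u\<in>I. S1 k u * (\<Sum>a\<in>I. T1 u a * S2 a j)) = S2 k j"
  proof -
    have "(\<Sum>u\<in>I. S1 k u * (\<Sum>a\<in>I. T1 u a * S2 a j)) =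
        (\<Sum>a\<in>I. (\<Sum>u\<in>I. S1 k u * T1 u a) * S2 a j)"
      by (simp add: sum_distrib_left sum_distrib_right mult.assoc) (rule sum.swap)
    then show ?thesis
      using I by (simp add: mat_inverseD[OF inv1] sum_kd assms(1))
  qed
  let ?x = "\<lambda>v. \<Sum>b\<in>I. S2 i b * T1 b v" and ?y = "\<lambda>u. \<Sum>a\<in>I. T1 u a * S2 a j"
  have "comm (S2 i j) (S1 k l) = - (\<Sum>u\<in>I. \<Sum>v\<in>I. S1 k u * comm (S2 i j) (T1 u v) * S1 v l)"
    using I by (intro comm_mat_inverse[OF assms(1) inv1])
  also have "\<dots> = (\<Sum>u\<in>I. \<Sum>v\<in>I. S1 k u * comm (T1 u v) (S2 i j) * S1 v l)"
    by (simp add: comm_swap[of "S2 i j"] sum_negf)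
  also have "\<dots> = (\<Sum>u\<in>I. \<Sum>v\<in>I. p * ((S1 k u * kd u j) * (?x v * S1 v l)) -
      p * ((S1 k u * ?y u) * (kd v i * S1 v l)))"
    using I by (intro sum.cong refl)
      (simp add: rtt_comm_inverse[OF assms(1) rtt inv2] kd_def algebra_simps central_left)
  also have "\<dots> = p * ((\<Sum>u\<in>I. S1 k u * kd u j) * (\<Sum>v\<in>I. ?x v * S1 v l)) -
      p * ((\<Sum>u\<in>I. S1 k u * ?y u) * (\<Sum>v\<in>I. kd v i * S1 v l))"
    unfolding sum_subtractf double_sum_product ..
  also have "\<dots> = p * (S1 k j * S2 i l - S2 k j * S1 i l)"
    using I by (simp only: 1 2 sum_kd[OF assms(1)] right_diff_distrib)
  finally show "comm (S2 i j) (S1 k l) = p * (S1 k j * S2 i l - S2 k j * S1 i l)" .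
qed

end

lemma central_uminus: "central p \<Longrightarrow> central (- p)"
  by (simp add: central_def)

section \<open>Schur complements against the eliminated rows and columns\<close>

context central
begin

text \<open>The Schur complement \<open>T2'\<close> is known only through its inverse, the J-block
  of \<open>S2\<close>. Outer entries commute with that block, as both deltas in
  \<open>rtt_comm_inverse\<close> vanish, hence also with its inverse.\<close>

lemma comm_below_inverse:
  assumes "finite I" and rtt: "rtt p I T1 T2" and inv: "mat_inverse I T2 S2"
    and J: "J \<subseteq> I" and inv': "mat_inverse J T2' S2"
    and ij: "i \<in> I - J" "j \<in> I - J" and kl: "k \<in> J" "l \<in> J"
  shows "comm (T1 i j) (T2' k l) = 0"
proof -
  have "comm (T1 i j) (S2 u v) = 0" if "u \<in> J" "v \<in> J" for u v
  proof -
    have "i \<noteq> v" "j \<noteq> u" using that ij by auto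
    then show ?thesis
      using that ij J by (subst rtt_comm_inverse[OF assms(1) rtt inv]) (auto simp: kd_def)
  qed
  with kl show ?thesis
    by (intro comm_mat_inverse_0[OF finite_subset[OF J assms(1)] mat_inverse_sym[OF inv']])
qed

text \<open>Row i is a(1, e), and row i of T S = 1 expresses \<open>S2 i l\<close> through the
  J-block of \<open>S2\<close>. So the mixed relation involves only e1 - e2, and passing to the
  inverse block contracts the sums. The factor \<open>a1\<close> commutes with \<open>T2'\<close>
  and is cancelled last.\<close>

lemma comm_row_below:
  assumes "finite J" "i \<notin> J" and rtt: "rtt p (insert i J) T1 T2"
    and inv: "mat_inverse (insert i J) T2 S2" and inv': "mat_inverse J T2' S2"
    and T1: "T1 i i = a1" "\<And>j. j \<in> J \<Longrightarrow> T1 i j = a1 * e1 j"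
    and T2: "T2 i i = a2" "\<And>j. j \<in> J \<Longrightarrow> T2 i j = a2 * e2 j"
    and unit: "h1 * a1 = 1" "h2 * a2 = 1"
    and J: "j \<in> J" "k \<in> J" "l \<in> J"
  shows "comm (e1 j) (T2' k l) = p * (T2' k j * (e1 l - e2 l))"
proof -
  have S: "S2 i l = - (\<Sum>m\<in>J. e2 m * S2 m l)" if "l \<in> J" for l
  proof -
    have "a2 * S2 i l + (\<Sum>m\<in>J. T2 i m * S2 m l) = kd i l"
      using that assms(1,2) mat_inverseD(1)[OF inv, of i l] T2(1) by simp
    moreover have "(\<Sum>m\<in>J. T2 i m * S2 m l) = a2 * (\<Sum>m\<in>J. e2 m * S2 m l)"
      by (simp add: T2 sum_distrib_left mult.assoc)
    moreover have "kd i l = (0::'b)"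
      using that assms(2) by (auto simp: kd_def)
    ultimately have "a2 * (S2 i l + (\<Sum>m\<in>J. e2 m * S2 m l)) = 0"
      by (simp only: distrib_left)
    then have "(h2 * a2) * (S2 i l + (\<Sum>m\<in>J. e2 m * S2 m l)) = 0"
      by (simp only: mult.assoc mult_zero_right)
    then show ?thesis
      by (simp only: unit mult_1_left eq_neg_iff_add_eq_0)
  qed
  have 1: "comm (T1 i j) (S2 u v) = - (p * (kd j u * (a1 * (\<Sum>m\<in>J. (e1 m - e2 m) * S2 m v))))"
    if "u \<in> J" "v \<in> J" for u v
  proof -
    have "(\<Sum>a\<in>J. T1 i a * S2 a v) = a1 * (\<Sum>m\<in>J. e1 m * S2 m v)"
      by (simp add: T1 sum_distrib_left mult.assoc)
    then have "(\<Sum>a\<in>insert i J. T1 i a * S2 a v) = a1 * (\<Sum>m\<in>J. (e1 m - e2 m) * S2 m v)"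
      using assms(1,2) that by (simp add: T1(1) S left_diff_distrib sum_subtractf right_diff_distrib)
    moreover have "kd i v = (0::'b)"
      using that assms(2) by (auto simp: kd_def)
    ultimately show ?thesis
      using that J assms(1) by (subst rtt_comm_inverse[OF _ rtt inv]) simp_all
  qed
  have 2: "comm a1 (T2' u v) = 0" if "u \<in> J" "v \<in> J" for u v
    using comm_below_inverse[OF _ rtt inv _ inv', of i i u v] that assms(1,2) T1 by auto
  have "comm (T1 i j) (T2' k l) =
      (\<Sum>u\<in>J. \<Sum>v\<in>J. p * ((T2' k u * kd j u) * (a1 * ((\<Sum>m\<in>J. (e1 m - e2 m) * S2 m v) * T2' v l))))"
    unfolding comm_mat_inverse[OF assms(1) mat_inverse_sym[OF inv'] J(2,3)] sum_negf[symmetric]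
    by (intro sum.cong refl) (simp add: 1 mult.assoc central_left)
  also have "\<dots> = p * (T2' k j * (a1 * (\<Sum>v\<in>J. (\<Sum>m\<in>J. (e1 m - e2 m) * S2 m v) * T2' v l)))"
    unfolding double_sum_product sum_kd(2)[OF assms(1) J(1)] by (simp only: sum_distrib_left)
  also have "(\<Sum>v\<in>J. (\<Sum>m\<in>J. (e1 m - e2 m) * S2 m v) * T2' v l) =
      (\<Sum>m\<in>J. (e1 m - e2 m) * (\<Sum>v\<in>J. S2 m v * T2' v l))"
    by (simp only: sum_distrib_left sum_distrib_right mult.assoc) (rule sum.swap)
  also have "\<dots> = (\<Sum>m\<in>J. (e1 m - e2 m) * kd m l)"
    using J by (intro sum.cong refl) (simp add: mat_inverseD(2)[OF inv'])
  also have "\<dots> = e1 l - e2 l"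
    by (rule sum_kd(1)[OF assms(1) J(3)])
  finally have "comm (T1 i j) (T2' k l) = p * (T2' k j * (a1 * (e1 l - e2 l)))" .
  moreover have "T2' k j * (a1 * (e1 l - e2 l)) = a1 * (T2' k j * (e1 l - e2 l))"
    using 2[OF J(2,1)] by (metis comm_def eq_iff_diff_eq_0 mult.assoc)
  ultimately have "comm (T1 i j) (T2' k l) = a1 * (p * (T2' k j * (e1 l - e2 l)))"
    by (simp only: central_left)
  moreover have "comm (T1 i j) (T2' k l) = a1 * comm (e1 j) (T2' k l)"
    using 2[OF J(2,3)] J by (simp add: T1 mult_comm)
  ultimately have "h1 * a1 * comm (e1 j) (T2' k l) = h1 * a1 * (p * (T2' k j * (e1 l - e2 l)))"
    by (simp add: mult.assoc)
  then show ?thesis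
    by (simp add: unit)
qed

text \<open>As \<open>a1\<close> and \<open>a2\<close> commute and \<open>p\<close> is central,
  \<open>a2\<close> comes out on the left of both sides and cancels.\<close>

lemma row_linear:
  assumes "comm a1 a2 = 0" "comm a1 (a2 * e2) = p * (a2 * (a1 * e1) - a1 * (a2 * e2))" "h2 * a2 = 1"
  shows "comm a1 e2 = p * (a1 * (e1 - e2))"
proof -
  have c: "a1 * a2 = a2 * a1"
    using assms(1) by (simp add: comm_def)
  have "a1 * (a2 * e2) = a2 * (a1 * e2)"
    by (metis c mult.assoc)
  then have "a2 * comm a1 e2 = a2 * (p * (a1 * (e1 - e2)))"
    using assms(1,2) by (simp add: comm_mult central_left right_diff_distrib)
  then have "(h2 * a2) * comm a1 e2 = (h2 * a2) * (p * (a1 * (e1 - e2)))"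
    by (simp only: mult.assoc)
  then show ?thesis
    by (simp only: assms(3) mult_1_left)
qed

end

text \<open>\<open>\<delta>\<close> is z - w up to sign and \<open>p\<close> its inverse;
  \<open>cancel\<close> lets a factor \<delta> + 1 be removed from the left.\<close>

locale rtt_pair = central +
  fixes \<delta> :: "'b::ring_1"
  assumes inv: "p * \<delta> = 1"
    and cancel: "\<And>x. \<delta> * x + x = 0 \<Longrightarrow> x = 0"
begin

text \<open>Multiplied by \<open>\<delta>\<close>, the hypothesis reads (\<delta> + 1) [x, y] =
  0.\<close>

lemma comm_self_0:
  assumes "comm x y = p * (y * x - x * y)"
  shows "comm x y = 0"
proof (rule cancel)
  have "\<delta> * comm x y = (p * \<delta>) * (y * x - x * y)"
    by (subst assms) (simp only: central mult.assoc)
  then show "\<delta> * comm x y + comm x y = 0"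
    by (simp add: inv comm_def)
qed

end

section \<open>Rows, columns and the two-by-two corner\<close>

definition row_rel :: "'b::ring_1 \<Rightarrow> (nat \<Rightarrow> 'b) \<Rightarrow> (nat \<Rightarrow> 'b) \<Rightarrow> nat set \<Rightarrow> bool" where
  "row_rel p u1 u2 J \<longleftrightarrow> (\<forall>j\<in>J. \<forall>l\<in>J. comm (u1 j) (u2 l) = p * (u2 j * u1 l - u1 j * u2 l))"

definition col_rel :: "'b::ring_1 \<Rightarrow> (nat \<Rightarrow> 'b) \<Rightarrow> (nat \<Rightarrow> 'b) \<Rightarrow> nat set \<Rightarrow> bool" where
  "col_rel p u1 u2 J \<longleftrightarrow> (\<forall>j\<in>J. \<forall>l\<in>J. comm (u1 j) (u2 l) = p * (u2 l * u1 j - u1 l * u2 j))"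

lemma rtt_row: "rtt p I T1 T2 \<Longrightarrow> i \<in> I \<Longrightarrow> row_rel p (T1 i) (T2 i) I"
  by (simp add: rtt_def row_rel_def)

lemma rtt_col: "rtt p I T1 T2 \<Longrightarrow> i \<in> I \<Longrightarrow> col_rel p (\<lambda>j. T1 j i) (\<lambda>j. T2 j i) I"
  by (simp add: rtt_def col_rel_def)

lemma (in central) col_rel_op:
  assumes "col_rel p u1 u2 J"
  shows "row_rel (Op p) (\<lambda>j. Op (u1 j)) (\<lambda>j. Op (u2 j)) J"
  unfolding row_rel_def
proof (intro ballI)
  fix j l assume "j \<in> J" "l \<in> J"
  then have "comm (u1 j) (u2 l) = p * (u2 l * u1 j - u1 l * u2 j)"
    using assms by (simp add: col_rel_def)
  then have "comm (u2 l) (u1 j) = (u1 l * u2 j - u2 l * u1 j) * p"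
    unfolding comm_swap[of "u2 l"] central[symmetric] by (simp add: right_diff_distrib)
  then show "comm (Op (u1 j)) (Op (u2 l)) = Op p * (Op (u2 j) * Op (u1 l) - Op (u1 j) * Op (u2 l))"
    by (simp only: comm_Op Op_simps)
qed

context rtt_pair
begin

text \<open>The corner has rows a, a e and f a, d + f a e, and \<open>Q\<close> is RTT for its
  off-diagonal entries. With a moved to the middle every product takes the form f (a1 a2) e; the
  terms with f cancel and only d remains.\<close>

lemma upper_lower_relation:
  assumes a: "comm a1 a2 = 0" "comm a1 d2 = 0" "comm a2 d1 = 0"
    and f: "comm a1 f2 = p * ((f2 - f1) * a1)"
    and e: "comm a1 e2 = p * (a1 * (e1 - e2))" "comm a2 e1 = - (p * (a2 * (e2 - e1)))"
    and Q: "comm (a1 * e1) (f2 * a2) =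
      p * ((d2 + f2 * a2 * e2) * a1 - (d1 + f1 * a1 * e1) * a2)"
    and unit: "h1 * a1 = 1" "a2 * h2 = 1"
  shows "comm e1 f2 = p * (d2 * h2 - h1 * d1)"
proof -
  define X where "X = e1 - e2"
  have c: "a2 * a1 = a1 * a2" "d2 * a1 = a1 * d2" "d1 * a2 = a2 * d1"
    using a by (simp_all add: comm_def)
  have 1: "e1 * a2 = a2 * (e1 - p * X)"
    using e(2) by (simp add: comm_def X_def algebra_simps central_left)
  have 2: "e2 * a1 = a1 * (e2 - p * X)"
    using e(1) by (simp add: comm_def X_def algebra_simps central_left)
  have 3: "a1 * f2 = (f2 + p * (f2 - f1)) * a1"
    using f by (simp add: comm_def algebra_simps)
  define m where "m = a1 * a2"
  have m1: "a1 * f2 * e1 * a2 = (f2 + p * (f2 - f1)) * (m * (e1 - p * X))"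
    unfolding m_def using 1 3 by (metis mult.assoc)
  have m2: "f2 * a2 * e2 * a1 = f2 * (m * (e2 - p * X))"
    unfolding m_def using 2 c by (metis mult.assoc)
  have m3: "f1 * a1 * e1 * a2 = f1 * (m * (e1 - p * X))"
    unfolding m_def using 1 by (metis mult.assoc)
  have m4: "f2 * a2 * (a1 * e1) = f2 * (m * e1)"
    unfolding m_def using c by (metis mult.assoc)
  have "a1 * comm e1 f2 * a2 = comm (a1 * e1) (f2 * a2) + f2 * a2 * (a1 * e1) - a1 * f2 * e1 * a2"
    by (simp add: comm_def algebra_simps)
  also have "\<dots> = p * ((d2 * a1 - d1 * a2) + f2 * (m * (e2 - p * X)) - f1 * (m * (e1 - p * X)))
      + f2 * (m * e1) - (f2 + p * (f2 - f1)) * (m * (e1 - p * X))"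
    unfolding Q distrib_right m1 m2 m3 m4 by (simp add: algebra_simps)
  also have "\<dots> = p * (d2 * a1 - d1 * a2)"
    by (simp add: X_def algebra_simps central_left[of f1] central_left[of f2] central_left[of m])
  finally have "h1 * (a1 * comm e1 f2 * a2) * h2 = h1 * (p * (d2 * a1 - d1 * a2)) * h2"
    by simp
  also have "\<dots> = p * (h1 * a1 * (d2 * h2) - h1 * d1 * (a2 * h2))"
    by (simp add: c(2) algebra_simps central_left[of h1])
  finally show ?thesis
    by (simp add: unit mult.assoc) (simp add: unit flip: mult.assoc)
qed

text \<open>With N = [x1, y2] + p (x1 - x2)(y1 - y2), the third equation is (\<delta> + 1) N =
  [x1, y1], written as two expressions for N. The commutator [x1, y1] lives in a single variable and
  stays unknown here.\<close>

lemma row_relations: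
  assumes R: "row_rel p u1 u2 J" "row_rel (- p) u2 u1 J" and J: "i \<in> J" "j \<in> J" "l \<in> J"
    and u: "u1 i = a1" "u2 i = a2" "u1 j = a1 * x1" "u2 j = a2 * x2" "u1 l = a1 * y1" "u2 l = a2 * y2"
    and unit: "h1 * a1 = 1" "h2 * a2 = 1"
  shows "comm a1 a2 = 0" "comm a1 x2 = p * (a1 * (x1 - x2))"
    "comm x1 y2 + p * ((x1 - x2) * (y1 - y2)) =
       comm x1 y1 - \<delta> * comm x1 y2 - (x1 - x2) * (y1 - y2)"
proof -
  have R1: "comm (u1 j) (u2 l) = p * (u2 j * u1 l - u1 j * u2 l)" if "j \<in> J" "l \<in> J" for j l
    using R(1) that by (simp add: row_rel_def)
  have R2: "comm (u2 j) (u1 l) = - p * (u1 j * u2 l - u2 j * u1 l)" if "j \<in> J" "l \<in> J" for j l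
    using R(2) that by (simp add: row_rel_def)
  interpret m: central "- p"
    by unfold_locales (simp add: central)
  show c: "comm a1 a2 = 0"
    using comm_self_0[of a1 a2] R1[of i i] J u by simp
  then have c': "comm a2 a1 = 0" "a1 * a2 = a2 * a1"
    by (simp_all add: comm_def)
  show x2: "comm a1 x2 = p * (a1 * (x1 - x2))"
    by (rule row_linear[OF c _ unit(2)])
      (use R1[of i j] J u in \<open>simp add: mult.assoc\<close>)
  have y2: "comm a1 y2 = p * (a1 * (y1 - y2))"
    by (rule row_linear[OF c _ unit(2)])
      (use R1[of i l] J u in \<open>simp add: mult.assoc\<close>)
  have x1: "comm a2 x1 = - p * (a2 * (x2 - x1))"
    by (rule m.row_linear[OF c'(1) _ unit(1)])
      (use R2[of i j] J u in \<open>simp add: mult.assoc\<close>)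
  have Q: "comm (a1 * x1) (a2 * y2) = p * (a2 * x2 * (a1 * y1) - a1 * x1 * (a2 * y2))"
    using R1[of j l] J u by simp
  define X where "X = x1 - x2"
  define Y where "Y = y1 - y2"
  have 1: "x1 * a2 = a2 * (x1 - p * X)"
    using x1 by (simp add: comm_def X_def algebra_simps central_left)
  have 2: "x2 * a1 = a1 * (x2 - p * X)"
    using x2 by (simp add: comm_def X_def algebra_simps central_left)
  have 3: "y2 * a1 = a1 * (y2 - p * Y)"
    using y2 by (simp add: comm_def Y_def algebra_simps central_left)
  \<comment> \<open>Both a-factors are collected on the left, at the price of corrections by p X and
    p Y, so that \<open>h2\<close> and \<open>h1\<close> can cancel them.\<close>
  have m1: "a1 * x1 * (a2 * y2) = (a1 * a2) * ((x1 - p * X) * y2)"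
    using 1 by (metis mult.assoc)
  have m2: "a2 * x2 * (a1 * y1) = (a1 * a2) * ((x2 - p * X) * y1)"
    using 2 c'(2) by (metis mult.assoc)
  have m3: "a2 * y2 * (a1 * x1) = (a1 * a2) * ((y2 - p * Y) * x1)"
    using 3 c'(2) by (metis mult.assoc)
  have "(a1 * a2) * ((x1 - p * X) * y2 - (y2 - p * Y) * x1) =
      (a1 * a2) * (p * ((x2 - p * X) * y1 - (x1 - p * X) * y2))"
    using Q unfolding comm_def m1 m2 m3 by (simp only: right_diff_distrib central_left)
  then have "(h2 * (h1 * (a1 * a2))) * ((x1 - p * X) * y2 - (y2 - p * Y) * x1) =
      (h2 * (h1 * (a1 * a2))) * (p * ((x2 - p * X) * y1 - (x1 - p * X) * y2))"
    by (simp only: mult.assoc)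
  moreover have "h2 * (h1 * (a1 * a2)) = 1"
    by (metis mult.assoc mult_1_left unit)
  ultimately have eq: "(x1 - p * X) * y2 - (y2 - p * Y) * x1 =
      p * ((x2 - p * X) * y1 - (x1 - p * X) * y2)"
    by (simp only: mult_1_left)
  have A: "comm x1 y2 = p * (x2 * Y - Y * x1) - p * (p * (X * Y))"
  proof -
    have "comm x1 y2 - (p * (x2 * Y - Y * x1) - p * (p * (X * Y))) =
        ((x1 - p * X) * y2 - (y2 - p * Y) * x1) -
        p * ((x2 - p * X) * y1 - (x1 - p * X) * y2)"
      by (simp add: comm_def X_def Y_def algebra_simps
          central_left[of x1] central_left[of x2] central_left[of y1] central_left[of y2])
    then show ?thesis
      using eq by simp
  qed
  have d: "\<delta> * (p * x) = x" for x
    by (metis central inv mult.assoc mult_1_left)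
  have "\<delta> * comm x1 y2 = x2 * Y - Y * x1 - p * (X * Y)"
    by (simp only: A right_diff_distrib d)
  then have "comm x1 y1 - \<delta> * comm x1 y2 - X * Y = comm x1 y2 + p * (X * Y)"
    by (simp only:) (simp add: comm_def X_def Y_def algebra_simps)
  then show "comm x1 y2 + p * ((x1 - x2) * (y1 - y2)) =
      comm x1 y1 - \<delta> * comm x1 y2 - (x1 - x2) * (y1 - y2)"
    unfolding X_def Y_def by (rule sym)
qed

lemma rtt_pair_op:
  assumes d: "\<And>x. \<delta> * x = x * \<delta>"
  shows "rtt_pair (Op p) (Op \<delta>)"
proof unfold_locales
  fix x :: "'b op"
  show "Op p * x = x * Op p"
    by (cases x) (simp only: Op_simps central)
  show "x = 0" if "Op \<delta> * x + x = 0"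
  proof (cases x)
    case (Op y)
    then have "\<delta> * y + y = 0"
      using that by (simp only: Op_simps d op.inject)
    then have "y = 0"
      by (rule cancel)
    then show ?thesis
      by (simp only: Op Op_simps)
  qed
  show "Op p * Op \<delta> = 1"
    by (simp only: Op_simps central[symmetric] inv)
qed

text \<open>These are the row relations of the opposite ring; reversing commutators exchanges the
  places of x and y in the last equation.\<close>

lemma col_relations:
  assumes d: "\<And>x. \<delta> * x = x * \<delta>"
    and R: "col_rel p u1 u2 J" "col_rel (- p) u2 u1 J" and J: "i \<in> J" "j \<in> J" "l \<in> J"
    and u: "u1 i = a1" "u2 i = a2" "u1 j = x1 * a1" "u2 j = x2 * a2" "u1 l = y1 * a1" "u2 l = y2 * a2"
    and unit: "a1 * h1 = 1" "a2 * h2 = 1"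
  shows "comm a1 x2 = p * ((x2 - x1) * a1)"
    "comm y2 x1 + p * ((y1 - y2) * (x1 - x2)) =
       comm y1 x1 - \<delta> * comm y2 x1 - (y1 - y2) * (x1 - x2)"
proof -
  interpret o: rtt_pair "Op p" "Op \<delta>"
    by (rule rtt_pair_op[OF d])
  interpret m: central "- p"
    by unfold_locales (simp add: central)
  have R2: "row_rel (- Op p) (\<lambda>j. Op (u2 j)) (\<lambda>j. Op (u1 j)) J"
    using m.col_rel_op[OF R(2)] by (simp only: Op_simps)
  have u': "Op (u1 i) = Op a1" "Op (u2 i) = Op a2" "Op (u1 j) = Op a1 * Op x1"
    "Op (u2 j) = Op a2 * Op x2" "Op (u1 l) = Op a1 * Op y1" "Op (u2 l) = Op a2 * Op y2"
    "Op h1 * Op a1 = 1" "Op h2 * Op a2 = 1"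
    by (simp_all only: Op_simps u unit)
  note r = o.row_relations[OF col_rel_op[OF R(1)] R2 J u']
  have "comm x2 a1 = (x1 - x2) * a1 * p"
    using r(2) by (simp only: comm_Op Op_simps op.inject)
  then have "comm x2 a1 = p * ((x1 - x2) * a1)"
    by (simp only: central)
  then show "comm a1 x2 = p * ((x2 - x1) * a1)"
    unfolding comm_swap[of a1] by (simp add: algebra_simps)
  show "comm y2 x1 + p * ((y1 - y2) * (x1 - x2)) =
       comm y1 x1 - \<delta> * comm y2 x1 - (y1 - y2) * (x1 - x2)"
    using r(3) unfolding comm_Op Op_simps op.inject central[symmetric] d[symmetric] .
qed

end

text \<open>Block inversion: the inverse has corner h + e S' f, borders - e S' and - S' f, and block
  S'. That S' reappears unchanged lets one inverse serve all Schur complements.\<close>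

lemma mat_inverse_bordered:
  fixes T' S' :: "nat \<Rightarrow> nat \<Rightarrow> 'b::ring_1"
  assumes J: "finite J" "i \<notin> J" and inv: "mat_inverse J T' S'"
    and a: "h * a = 1" "a * h = 1"
    and T: "T i i = a" "\<And>j. j \<in> J \<Longrightarrow> T i j = a * e j" "\<And>j. j \<in> J \<Longrightarrow> T j i = f j * a"
      "\<And>j k. j \<in> J \<Longrightarrow> k \<in> J \<Longrightarrow> T j k = f j * a * e k + T' j k"
  obtains S where "mat_inverse (insert i J) T S" "\<And>j k. j \<in> J \<Longrightarrow> k \<in> J \<Longrightarrow> S j k = S' j k"
proof -
  define P where "P k = (\<Sum>m\<in>J. e m * S' m k)" for k
  define Q where "Q j = (\<Sum>m\<in>J. S' j m * f m)" for j
  define w where "w = (\<Sum>j\<in>J. e j * Q j)"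
  define S where "S j k = (if j = i then if k = i then h + w else - P k
      else if k = i then - Q j else S' j k)" for j k
  have w: "w = (\<Sum>k\<in>J. P k * f k)"
    unfolding w_def Q_def P_def
    by (simp add: sum_distrib_left sum_distrib_right mult.assoc) (rule sum.swap)
  have TQ: "(\<Sum>k\<in>J. T' j k * Q k) = f j" if "j \<in> J" for j
  proof -
    have "(\<Sum>k\<in>J. T' j k * Q k) = (\<Sum>m\<in>J. (\<Sum>k\<in>J. T' j k * S' k m) * f m)"
      unfolding Q_def
      by (simp add: sum_distrib_left sum_distrib_right mult.assoc) (rule sum.swap)
    also have "\<dots> = (\<Sum>m\<in>J. kd j m * f m)"
      using that by (intro sum.cong refl) (simp add: mat_inverseD(1)[OF inv])
    finally show ?thesis
      using sum_kd(4)[OF J(1) that, of f] by simp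
  qed
  have PT: "(\<Sum>j\<in>J. P j * T' j k) = e k" if "k \<in> J" for k
  proof -
    have "(\<Sum>j\<in>J. P j * T' j k) = (\<Sum>m\<in>J. e m * (\<Sum>j\<in>J. S' m j * T' j k))"
      unfolding P_def
      by (simp add: sum_distrib_left sum_distrib_right mult.assoc) (rule sum.swap)
    also have "\<dots> = (\<Sum>m\<in>J. e m * kd m k)"
      using that by (intro sum.cong refl) (simp add: mat_inverseD(2)[OF inv])
    finally show ?thesis
      using sum_kd(1)[OF J(1) that, of e] by simp
  qed
  have S: "S i i = h + w" "\<And>j. j \<in> J \<Longrightarrow> S i j = - P j" "\<And>j. j \<in> J \<Longrightarrow> S j i = - Q j"
    "\<And>j k. j \<in> J \<Longrightarrow> k \<in> J \<Longrightarrow> S j k = S' j k"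
    using J(2) by (auto simp: S_def)
  have ne: "j \<noteq> i" if "j \<in> J" for j using that J(2) by auto
  have ins: "(\<Sum>k\<in>insert i J. F k) = F i + (\<Sum>k\<in>J. F k)" for F :: "nat \<Rightarrow> 'b"
    using J by simp
  have kd: "kd i i = (1::'b)" "\<And>j. j \<in> J \<Longrightarrow> kd i j = (0::'b)" "\<And>j. j \<in> J \<Longrightarrow> kd j i = (0::'b)"
    using J(2) by (auto simp: kd_def)
  have aeq: "a * (\<Sum>j\<in>J. G j) = (\<Sum>j\<in>J. a * G j)" "(\<Sum>j\<in>J. G j) * a = (\<Sum>j\<in>J. G j * a)" for G
    by (simp_all add: sum_distrib_left sum_distrib_right)
  have aa: "h * (a * x) = x" "a * (h * x) = x" for x
    by (simp_all add: a flip: mult.assoc)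
  have "mat_inverse (insert i J) T S"
    unfolding mat_inverse_def
  proof (intro ballI)
    fix j k assume jk: "j \<in> insert i J" "k \<in> insert i J"
    consider "j = i" "k = i" | "j = i" "k \<in> J" | "j \<in> J" "k = i" | "j \<in> J" "k \<in> J"
      using jk by blast
    then show "(\<Sum>l\<in>insert i J. T j l * S l k) = kd j k \<and> (\<Sum>l\<in>insert i J. S j l * T l k) = kd j k"
    proof cases
      case 1
      have "(\<Sum>l\<in>J. T i l * S l i) = - (a * w)"
        unfolding w_def by (simp add: T S sum_negf sum_distrib_left mult.assoc)
      moreover have "(\<Sum>l\<in>J. S i l * T l i) = - (w * a)"
        unfolding w by (simp add: T S sum_negf sum_distrib_right mult.assoc)
      ultimately show ?thesis
        by (simp add: 1 ins T S kd algebra_simps a)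
    next
      case 2
      have A: "(\<Sum>l\<in>J. T i l * S l k) = a * P k"
        using 2 unfolding P_def by (simp add: T S sum_distrib_left mult.assoc)
      have B: "(\<Sum>l\<in>J. S i l * T l k) = - (w * a * e k) - (\<Sum>l\<in>J. P l * T' l k)"
        unfolding w using 2
        by (simp add: T S sum_negf sum_subtractf sum_distrib_right mult.assoc distrib_left)
      have "(\<Sum>l\<in>insert i J. T j l * S l k) = a * (- P k) + a * P k"
        unfolding 2(1) ins A using 2 by (simp add: T S)
      moreover have "(\<Sum>l\<in>insert i J. S j l * T l k) = (h + w) * (a * e k) + (- (w * a * e k) - e k)"
        unfolding 2(1) ins B PT[OF 2(2)] using 2 by (simp add: T S)
      ultimately show ?thesis
        using 2 by (simp add: kd distrib_right aa mult.assoc)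
    next
      case 3
      have A: "(\<Sum>l\<in>J. T j l * S l i) = - (f j * a * w) - (\<Sum>l\<in>J. T' j l * Q l)"
        unfolding w_def using 3
        by (simp add: T S sum_negf sum_subtractf sum_distrib_left mult.assoc distrib_right)
      have B: "(\<Sum>l\<in>J. S j l * T l i) = Q j * a"
        using 3 unfolding Q_def by (simp add: T S sum_distrib_right mult.assoc)
      have "(\<Sum>l\<in>insert i J. T j l * S l k) = f j * a * (h + w) + (- (f j * a * w) - f j)"
        unfolding 3(2) ins A TQ[OF 3(1)] using 3 by (simp add: T S)
      moreover have "(\<Sum>l\<in>insert i J. S j l * T l k) = - Q j * a + Q j * a"
        unfolding 3(2) ins B using 3 by (simp add: T S)
      ultimately show ?thesis
        using 3 by (simp add: kd distrib_left mult.assoc a)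
    next
      case 4
      have "(\<Sum>l\<in>J. T j l * S l k) = f j * a * P k + kd j k"
        unfolding P_def mat_inverseD(1)[OF inv 4, symmetric] using 4
        by (simp add: T S sum_distrib_left mult.assoc distrib_right sum.distrib)
      moreover have "(\<Sum>l\<in>J. S j l * T l k) = Q j * a * e k + kd j k"
        unfolding Q_def mat_inverseD(2)[OF inv 4, symmetric] using 4
        by (simp add: T S sum_distrib_right mult.assoc distrib_left sum.distrib)
      ultimately show ?thesis
        using 4 by (simp add: ins T S kd algebra_simps)
    qed
  qed
  then show ?thesis
    using that S(4) by blast
qed

lemma mat_inverse_cong:
  assumes "mat_inverse I T S" "\<And>j k. j \<in> I \<Longrightarrow> k \<in> I \<Longrightarrow> S j k = S' j k"
  shows "mat_inverse I T S'"
  using assms unfolding mat_inverse_def by simp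

text \<open>Each step trades r for s, keeping r + s, until r = d. In the uses d is the index of a
  leading coefficient 1, whose commutators vanish.\<close>

lemma commutator_recursion:
  fixes C :: "int \<Rightarrow> int \<Rightarrow> 'b::ring_1"
  assumes rec: "\<And>r s. d \<le> r \<Longrightarrow> 1 \<le> s \<Longrightarrow> C (r + 1) s = C r (s + 1) + P r s"
    and base: "\<And>s. 1 \<le> s \<Longrightarrow> C d s = 0" and rs: "d \<le> r" "1 \<le> s"
  shows "C r s = (\<Sum>u\<in>{d..r - 1}. P u (r + s - u - 1))"
  using rs
proof (induction r arbitrary: s rule: int_ge_induct)
  case base
  then show ?case by (simp add: assms(2))
next
  case (step r)
  have "{d..r + 1 - 1} = insert r {d..r - 1}" using step.hyps by auto
  then have "(\<Sum>u\<in>{d..r + 1 - 1}. P u (r + 1 + s - u - 1)) =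
      P r s + (\<Sum>u\<in>{d..r - 1}. P u (r + (s + 1) - u - 1))"
    by (simp add: algebra_simps)
  then show ?case
    using step.IH[of "s + 1"] step.prems step.hyps rec[of r s] by simp
qed

definition serre :: "'b::ring_1 \<Rightarrow> 'b \<Rightarrow> 'b \<Rightarrow> 'b" where
  "serre u v y = comm u (comm v y) + comm v (comm u y)"

text \<open>Commuting with the Cartan coefficient \<open>A\<close> raises the index of \<open>y\<close>.\<close>

lemma serre_shift:
  fixes u :: "'b::ring_1"
  assumes 0: "serre u v y = 0" and A: "comm A u = 0" "comm A v = 0"
    and B: "comm B u = 0" "comm B v = 0"
    and y: "comm A y = y' + B * y \<or> comm A y = - (y' + B * y)"
  shows "serre u v y' = 0"
proof -
  have jac: "comm A (comm x z) = comm x (comm A z)" if "comm A x = 0" for x z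
  proof -
    have "comm A (comm x z) = comm (comm A x) z + comm x (comm A z)"
      by (simp add: comm_def algebra_simps)
    then show ?thesis using that by simp
  qed
  have Bm: "comm x (B * z) = B * comm x z" if "comm B x = 0" for x z
    using that by (simp add: comm_mult comm_swap[of x B])
  have "serre u v (comm A y) = comm A (serre u v y)"
    unfolding serre_def comm_add by (simp add: jac A)
  then have 1: "serre u v (comm A y) = 0"
    using 0 by simp
  have "serre u v (B * y) = B * serre u v y"
    unfolding serre_def by (simp add: Bm B distrib_left)
  then have 2: "serre u v (B * y) = 0"
    using 0 by simp
  have add: "serre u v (z + z') = serre u v z + serre u v z'" for z z'
    unfolding serre_def by (simp add: comm_add algebra_simps)
  have neg: "serre u v (- z) = - serre u v z" for z
    unfolding serre_def by simp
  have "serre u v (y' + B * y) = 0"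
    using y
  proof
    assume "comm A y = y' + B * y"
    with 1 show ?thesis by (simp only:)
  next
    assume "comm A y = - (y' + B * y)"
    with 1 have "- serre u v (y' + B * y) = 0" by (simp only: neg)
    then show ?thesis by (simp only: neg_equal_0_iff_equal)
  qed
  then show ?thesis
    using 2 by (simp add: add)
qed

text \<open>The signs from reversing the inner and the outer commutator cancel.\<close>

lemma serre_Op: "serre (Op u) (Op v) (Op y) = Op (serre u v y)" for u :: "'b::ring_1"
  by (simp add: serre_def comm_Op Op_simps comm_swap[of _ u] comm_swap[of _ v])

section \<open>RTT relations for Laurent series\<close>

definition zwi :: "'a::ring_1 fls fls" where
  "zwi = (SOME p. p * zw = 1 \<and> (\<forall>x. p * x = x * p))"

lemma zwi: "zwi * zw = (1 :: 'a::ring_1 fls fls)" "zwi * x = x * (zwi :: 'a fls fls)"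
proof -
  have "\<exists>p :: 'a fls fls. p * zw = 1 \<and> (\<forall>x. p * x = x * p)"
    by (metis zw_inverse)
  then have *: "zwi * zw = (1 :: 'a fls fls) \<and> (\<forall>x :: 'a fls fls. zwi * x = x * zwi)"
    unfolding zwi_def by (rule someI_ex)
  show "zwi * zw = (1 :: 'a fls fls)" "zwi * x = x * (zwi :: 'a fls fls)"
    using * by blast+
qed

text \<open>The sign 1 belongs to T(z) and its Schur complements, -1 to their inverses.\<close>

definition zsign :: "'a::ring_1 fls fls \<Rightarrow> bool" where
  "zsign \<sigma> \<longleftrightarrow> \<sigma> = 1 \<or> \<sigma> = -1"

lemma zsign_rtt_pair:
  assumes "zsign \<sigma>"
  shows "rtt_pair (\<sigma> * zwi) (\<sigma> * zw)"
proof unfold_locales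
  have s: "\<sigma> * x = x * \<sigma>" "\<sigma> * (\<sigma> * x) = x" for x
    using assms by (auto simp: zsign_def)
  show "\<sigma> * zwi * x = x * (\<sigma> * zwi)" for x
    by (metis s(1) zwi(2) mult.assoc)
  show "\<sigma> * zwi * (\<sigma> * zw) = 1"
    by (metis s mult.assoc zwi(1))
  show "x = 0" if "\<sigma> * zw * x + x = 0" for x
  proof (rule zw_pm_one_cancel)
    show "\<sigma> = 1 \<or> \<sigma> = -1" using assms by (simp add: zsign_def)
    have "\<sigma> * (\<sigma> * zw * x + x) = 0" using that by simp
    then show "zw * x + \<sigma> * x = 0" by (simp only: distrib_left mult.assoc s(2))
  qed
qed

text \<open>Both orders of the variables are recorded, because the second cannot be had from the
  first by exchanging z and w in the iterated ring.\<close>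

definition RTT :: "'a::ring_1 fls fls \<Rightarrow> nat set \<Rightarrow> (nat \<Rightarrow> nat \<Rightarrow> 'a fls) \<Rightarrow> bool" where
  "RTT \<sigma> I T \<longleftrightarrow>
     rtt (\<sigma> * zwi) I (\<lambda>i j. inz (T i j)) (\<lambda>i j. inw (T i j)) \<and>
     rtt (- (\<sigma> * zwi)) I (\<lambda>i j. inw (T i j)) (\<lambda>i j. inz (T i j))"

lemma zw_cancel: "zw * M = zw * N \<Longrightarrow> M = N"
  by (metis zwi(1) mult.assoc mult_1_left)

lemma zw_zwi: "zw * (zwi * x) = x"
  by (metis zwi mult.assoc mult_1_left)

lemma RTT_coeffI:
  assumes "\<And>i j k l r s. i \<in> I \<Longrightarrow> j \<in> I \<Longrightarrow> k \<in> I \<Longrightarrow> l \<in> I \<Longrightarrow>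
    comm (T i j $$ (r + 1)) (T k l $$ s) - comm (T i j $$ r) (T k l $$ (s + 1)) =
       T k j $$ s * T i l $$ r - T k j $$ r * T i l $$ s"
  shows "RTT 1 I T"
  unfolding RTT_def rtt_def mult_1_left
proof (intro conjI ballI)
  fix i j k l assume I: "i \<in> I" "j \<in> I" "k \<in> I" "l \<in> I"
  show "comm (inz (T i j)) (inw (T k l)) =
      zwi * (inw (T k j) * inz (T i l) - inz (T k j) * inw (T i l))"
    by (rule zw_cancel, unfold zw_zwi, rule fls2_eqI)
      (use assms[OF I] in \<open>simp add: cf_zw comm_def\<close>)
  show "comm (inw (T i j)) (inz (T k l)) =
      - zwi * (inz (T k j) * inw (T i l) - inw (T k j) * inz (T i l))"
    unfolding mult_minus_left mult_minus_right[symmetric] minus_diff_eq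
    by (rule zw_cancel, unfold zw_zwi, rule fls2_eqI)
      (use assms[OF I] in \<open>simp add: cf_zw comm_def algebra_simps\<close>)
qed

lemma inz_kd: "inz (kd i j) = kd i j" and inw_kd: "inw (kd i j) = kd i j"
  by (simp_all add: kd_def)

lemma mat_inverse_inz:
  "mat_inverse I T S \<Longrightarrow> mat_inverse I (\<lambda>i j. inz (T i j)) (\<lambda>i j. inz (S i j))"
  unfolding mat_inverse_def by (simp flip: inz_mult inz_sum add: inz_kd)

lemma mat_inverse_inw:
  "mat_inverse I T S \<Longrightarrow> mat_inverse I (\<lambda>i j. inw (T i j)) (\<lambda>i j. inw (S i j))"
  unfolding mat_inverse_def
  by (simp flip: inw_mult fls_const_sum add: inw_kd del: fls_const_mult_const)

lemma RTT_inverse: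
  assumes s: "zsign \<sigma>" and "finite I" and R: "RTT \<sigma> I T" and inv: "mat_inverse I T S"
  shows "RTT (- \<sigma>) I S"
proof -
  interpret a: rtt_pair "\<sigma> * zwi" "\<sigma> * zw"
    by (rule zsign_rtt_pair[OF s])
  interpret b: central "- (\<sigma> * zwi)"
    by (rule central_uminus) unfold_locales
  note inv = mat_inverse_inz[OF inv] mat_inverse_inw[OF inv]
  show ?thesis
    using a.rtt_inverse[OF assms(2) _ inv] b.rtt_inverse[OF assms(2) _ inv(2,1)] R
    by (simp add: RTT_def)
qed

lemma RTT_mono: "RTT \<sigma> I T \<Longrightarrow> J \<subseteq> I \<Longrightarrow> RTT \<sigma> J T"
  unfolding RTT_def using rtt_mono by blast

lemma RTT_below:
  assumes "zsign \<sigma>" "finite I" "RTT \<sigma> I T" "mat_inverse I T S" "J \<subseteq> I" "mat_inverse J T' S"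
  shows "RTT \<sigma> J T'"
proof -
  have "RTT (- \<sigma>) J S"
    using RTT_inverse[OF assms(1-4)] assms(5) by (rule RTT_mono)
  then have "RTT (- (- \<sigma>)) J T'"
    using assms finite_subset[OF assms(5,2)]
    by (intro RTT_inverse[OF _ _ _ mat_inverse_sym[OF assms(6)]]) (auto simp: zsign_def)
  then show ?thesis by simp
qed

lemma RTT_below_comm:
  assumes "finite I" "RTT 1 I T" "mat_inverse I T S" "J \<subseteq> I" "mat_inverse J T' S"
    "i \<in> I - J" "j \<in> I - J" "k \<in> J" "l \<in> J"
  shows "comm (inz (T i j)) (inw (T' k l)) = 0"
proof -
  interpret a: rtt_pair "1 * zwi" "1 * zw"
    by (rule zsign_rtt_pair) (simp add: zsign_def)
  show ?thesis
    using a.comm_below_inverse[where ?T1.0 = "\<lambda>i j. inz (T i j)", OF assms(1) _ mat_inverse_inw[OF assms(3)] assms(4)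
        mat_inverse_inw[OF assms(5)] assms(6-9)] assms(2)
    by (simp add: RTT_def)
qed

lemma comm_series:
  assumes "\<And>r s. comm (f $$ r) (g $$ s) = 0"
  shows "comm f g = 0" "comm (inz f) (inw g) = 0" "comm (inw f) (inz g) = 0"
proof -
  have *: "f $$ r * g $$ s = g $$ s * f $$ r" for r s
    using assms[of r s] by (simp add: comm_def)
  show "comm (inz f) (inw g) = 0" "comm (inw f) (inz g) = 0"
    by (rule fls2_eqI, simp add: comm_def *)+
  have "f * g = g * f"
  proof (rule fls_eqI)
    fix n
    show "(f * g) $$ n = (g * f) $$ n"
      unfolding fls_times_nth(2) *
      by (rule sum.reindex_bij_witness[of _ "\<lambda>i. n - i" "\<lambda>i. n - i"]) auto
  qed
  then show "comm f g = 0"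
    by (simp add: comm_def)
qed

section \<open>Quadratic relations of series in negative powers\<close>

definition neg_supp :: "'a::ring_1 fls \<Rightarrow> bool" where
  "neg_supp f \<longleftrightarrow> (\<forall>r\<le>0. f $$ r = 0)"

lemma neg_supp_mult: "neg_supp f \<Longrightarrow> neg_supp g \<Longrightarrow> neg_supp (f * g)"
  unfolding neg_supp_def by (subst fls_mult_nth_bounds[where a = 1 and b = 1]) auto

lemma cf_diff_mult:
  "cf ((inz x - inw x) * (inz y - inw y)) r s =
    (if s = 0 then (x * y) $$ r else 0) + (if r = 0 then (x * y) $$ s else 0)
      - x $$ r * y $$ s - x $$ s * y $$ r"
  by (simp add: algebra_simps cf_mult_inw_inw cf_mult_inz_inz cf_inw cf_inz)

text \<open>The term \<open>K\<close> below, a commutator in the single variable \<open>z\<close>, is not computed by the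
  RTT relation; it vanishes because \<open>(z - w \<plusminus> 1) N = \<plusminus>K\<close> has no other solution.\<close>

lemma quadratic_relation:
  assumes s: "zsign \<sigma>"
    and eq: "A + (\<sigma> * zwi) * P = K - (\<sigma> * zw) * A - P"
    and A: "\<And>r s. s \<le> 0 \<Longrightarrow> cf A r s = 0" "\<And>r s. r \<le> 0 \<Longrightarrow> cf A r s = 0"
    and K: "\<And>r s. s \<noteq> 0 \<Longrightarrow> cf K r s = 0"
    and P: "\<And>r s. s < 0 \<Longrightarrow> cf P r s = 0" "\<And>r s. cf P r s = cf P s r"
  shows "\<sigma> * (zw * A) = - P" "cf A r s + cf A s r = 0"
proof -
  interpret a: rtt_pair "\<sigma> * zwi" "\<sigma> * zw"
    by (rule zsign_rtt_pair[OF s])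
  have ss: "\<sigma> = 1 \<or> \<sigma> = -1"
    using s by (simp add: zsign_def)
  have sN: "cf (\<sigma> * N) r s = 0" if "cf N r s = 0" for r s N
    using ss that by auto
  define N where "N = K - (\<sigma> * zw) * A - P"
  have dp: "(\<sigma> * zw) * ((\<sigma> * zwi) * P) = P"
    by (metis a.inv a.central mult.assoc mult_1_left)
  have N: "(\<sigma> * zw) * N = K - N"
    unfolding N_def eq[symmetric] distrib_left dp by (simp add: eq)
  have "zw * N + \<sigma> * N = \<sigma> * K"
    using N ss by (auto simp: algebra_simps)
  moreover have "cf N r s = 0" if "s < 0" for r s
    unfolding N_def using that
    by (simp add: K P mult.assoc sN cf_zw A)
  ultimately have "N = 0"
    using ss by (intro zw_shift_cancel[of N \<sigma>]) (simp_all add: K sN)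
  then have "K = 0"
    using N by simp
  then have "- (\<sigma> * (zw * A)) = P"
    using \<open>N = 0\<close> unfolding N_def by (simp add: mult.assoc)
  then have "- (- (\<sigma> * (zw * A))) = - P"
    by (simp only:)
  then show 1: "\<sigma> * (zw * A) = - P"
    by (simp only: minus_minus)
  then have 2: "zw * A = - (\<sigma> * P)"
    using ss by (auto simp: algebra_simps)
  have P': "cf (\<sigma> * P) r s = cf (\<sigma> * P) s r" for r s
    using ss P(2)[of r s] by auto
  have rec: "cf A (r + 1) s = cf A r (s + 1) - cf (\<sigma> * P) r s" for r s
    using arg_cong[OF 2, of "\<lambda>M. cf M r s"] by (simp add: cf_zw algebra_simps)
  have rec': "cf A s (r + 1) = cf A (s + 1) r + cf (\<sigma> * P) r s" for r s
    using rec[of s r] P'[of r s] by simp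
  \<comment> \<open>\<open>rec\<close> and \<open>rec'\<close> move in opposite directions along
    constant r + s, with opposite corrections since P is symmetric. The sum is thus carried
    unchanged to r = 0, where both terms vanish.\<close>
  have "\<forall>s. cf A r s + cf A s r = 0"
  proof (cases "r \<le> 0")
    case True
    then show ?thesis by (simp add: A)
  next
    case False
    then have "0 \<le> r" by simp
    then show ?thesis
    proof (induction r rule: int_ge_induct)
      case base
      then show ?case by (simp add: A)
    next
      case (step r)
      show ?case
      proof
        fix s
        have "cf A (r + 1) s + cf A s (r + 1) = cf A r (s + 1) + cf A (s + 1) r"
          unfolding rec[of r s] rec'[of s r] by simp
        then show "cf A (r + 1) s + cf A s (r + 1) = 0"
          using step.IH by simp
      qed
    qed
  qed
  then show "cf A r s + cf A s r = 0" by blast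
qed

lemma cf_diff_mult_low:
  assumes "neg_supp x" "neg_supp y" "s < 0"
  shows "cf ((inz x - inw x) * (inz y - inw y)) r s = 0"
  using assms neg_supp_mult[OF assms(1,2)] unfolding cf_diff_mult
  by (simp add: neg_supp_def)

lemma cf_diff_mult_sym:
  "cf ((inz x - inw x) * (inz y - inw y)) r s = cf ((inz x - inw x) * (inz y - inw y)) s r"
  unfolding cf_diff_mult by simp

lemma cf_comm [simp]:
  "cf (comm (inz x) (inw y)) r s = comm (x $$ r) (y $$ s)"
  "cf (comm (inw y) (inz x)) r s = comm (y $$ s) (x $$ r)"
  by (simp_all add: comm_def)

lemma RTT_diag:
  assumes "RTT 1 I T" "i \<in> I"
  shows "comm (inz (T i i)) (inw (T i i)) = 0"
proof -
  interpret a: rtt_pair "1 * zwi" "1 * zw"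
    by (rule zsign_rtt_pair) (simp add: zsign_def)
  show ?thesis
    using assms by (intro a.comm_self_0) (simp add: RTT_def rtt_def)
qed

text \<open>The fourth conclusion becomes a Serre relation once the coefficients of y are
  commutators with those of x.\<close>

lemma RTT_row:
  assumes s: "zsign \<sigma>" and R: "RTT \<sigma> I T" and I: "i \<in> I" "j \<in> I" "l \<in> I"
    and T: "T i i = a" "T i j = a * x" "T i l = a * y" and unit: "h * a = 1"
    and supp: "neg_supp x" "neg_supp y"
  shows "comm (inz a) (inw a) = 0"
    "comm (inz a) (inw x) = \<sigma> * zwi * (inz a * (inz x - inw x))"
    "\<sigma> * (zw * comm (inz x) (inw y)) = - ((inz x - inw x) * (inz y - inw y))"
    "comm (x $$ r) (y $$ s) + comm (x $$ s) (y $$ r) = 0"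
proof -
  interpret a: rtt_pair "\<sigma> * zwi" "\<sigma> * zw"
    by (rule zsign_rtt_pair[OF s])
  have R1: "row_rel (\<sigma> * zwi) (\<lambda>j. inz (T i j)) (\<lambda>j. inw (T i j)) I"
    and R2: "row_rel (- (\<sigma> * zwi)) (\<lambda>j. inw (T i j)) (\<lambda>j. inz (T i j)) I"
    using R I by (auto simp: RTT_def dest: rtt_row)
  have u: "inz h * inz a = 1" "inw h * inw a = 1"
    by (simp_all only: inz_mult[symmetric] inw_mult[symmetric] unit inz_1 fls_const_1)
  note r = a.row_relations[OF R1 R2 I, unfolded T inz_mult inw_mult, OF refl refl refl refl refl refl u]
  show "comm (inz a) (inw a) = 0"
    "comm (inz a) (inw x) = \<sigma> * zwi * (inz a * (inz x - inw x))"
    by (fact r(1,2))+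
  have A: "cf (comm (inz x) (inw y)) r s = 0" if "s \<le> 0 \<or> r \<le> 0" for r s
    using that supp by (auto simp: neg_supp_def)
  have K: "cf (comm (inz x) (inz y)) r s = 0" if "s \<noteq> 0" for r s
    using that by (simp add: comm_def cf_mult_inz_inz)
  note q = quadratic_relation[OF s r(3) A A K cf_diff_mult_low[OF supp] cf_diff_mult_sym]
  show "\<sigma> * (zw * comm (inz x) (inw y)) = - ((inz x - inw x) * (inz y - inw y))"
    by (rule q) auto
  have "cf (comm (inz x) (inw y)) r s + cf (comm (inz x) (inw y)) s r = 0"
    by (rule q) auto
  then show "comm (x $$ r) (y $$ s) + comm (x $$ s) (y $$ r) = 0"
    by simp
qed

text \<open>Both signs occur: 1 for the f-series, -1 for a column of the inverse matrix.\<close>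

lemma RTT_col:
  assumes s: "zsign \<sigma>" and R: "RTT \<sigma> I T" and I: "i \<in> I" "j \<in> I" "l \<in> I"
    and T: "T i i = a" "T j i = x * a" "T l i = y * a" and unit: "a * h = 1"
    and supp: "neg_supp x" "neg_supp y"
  shows "comm (inz a) (inw x) = \<sigma> * zwi * ((inw x - inz x) * inz a)"
    "comm (x $$ r) (y $$ s) + comm (x $$ s) (y $$ r) = 0"
proof -
  interpret a: rtt_pair "\<sigma> * zwi" "\<sigma> * zw"
    by (rule zsign_rtt_pair[OF s])
  have R1: "col_rel (\<sigma> * zwi) (\<lambda>j. inz (T j i)) (\<lambda>j. inw (T j i)) I"
    and R2: "col_rel (- (\<sigma> * zwi)) (\<lambda>j. inw (T j i)) (\<lambda>j. inz (T j i)) I"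
    using R I by (auto simp: RTT_def dest: rtt_col)
  have u: "inz a * inz h = 1" "inw a * inw h = 1"
    by (simp_all only: inz_mult[symmetric] inw_mult[symmetric] unit inz_1 fls_const_1)
  have d: "\<sigma> * zw * x = x * (\<sigma> * zw)" for x
    using s by (auto simp: zsign_def zw_central)
  note r = a.col_relations[OF d R1 R2 I, unfolded T inz_mult inw_mult, OF refl refl refl refl refl refl u]
  show "comm (inz a) (inw x) = \<sigma> * zwi * ((inw x - inz x) * inz a)"
    by (fact r(1))
  have A: "cf (comm (inw y) (inz x)) r s = 0" if "s \<le> 0 \<or> r \<le> 0" for r s
    using that supp by (auto simp: neg_supp_def)
  have K: "cf (comm (inz y) (inz x)) r s = 0" if "s \<noteq> 0" for r s
    using that by (simp add: comm_def cf_mult_inz_inz)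
  note q = quadratic_relation[OF s r(2) A A K cf_diff_mult_low[OF supp(2,1)] cf_diff_mult_sym]
  have "cf (comm (inw y) (inz x)) r s + cf (comm (inw y) (inz x)) s r = 0"
    by (rule q) auto
  then show "comm (x $$ r) (y $$ s) + comm (x $$ s) (y $$ r) = 0"
    unfolding cf_comm comm_swap[of "y $$ _"] by (simp add: neg_eq_iff_add_eq_0 add.commute)
qed

lemma RTT_row_below:
  assumes "finite J" "i \<notin> J" and R: "RTT 1 (insert i J) T"
    and inv: "mat_inverse (insert i J) T S" and inv': "mat_inverse J T' S"
    and T: "T i i = a" "\<And>j. j \<in> J \<Longrightarrow> T i j = a * e j" and unit: "h * a = 1"
    and J: "j \<in> J" "k \<in> J" "l \<in> J"
  shows "zw * comm (inz (e j)) (inw (T' k l)) = inw (T' k j) * (inz (e l) - inw (e l))"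
proof -
  interpret a: rtt_pair "1 * zwi" "1 * zw"
    by (rule zsign_rtt_pair) (simp add: zsign_def)
  have "comm (inz (e j)) (inw (T' k l)) = (1 * zwi) * (inw (T' k j) * (inz (e l) - inw (e l)))"
  proof (rule a.comm_row_below[OF assms(1,2) _ mat_inverse_inw[OF inv] mat_inverse_inw[OF inv']
        _ _ _ _ _ _ J])
    show "rtt (1 * zwi) (insert i J) (\<lambda>i j. inz (T i j)) (\<lambda>i j. inw (T i j))"
      using R by (simp add: RTT_def)
    show "inz h * inz a = 1" "inw h * inw a = 1"
      by (simp_all only: inz_mult[symmetric] inw_mult[symmetric] unit inz_1 fls_const_1)
    show "inz (T i i) = inz a" "inw (T i i) = inw a"
      by (simp_all only: T)
    show "inz (T i j) = inz a * inz (e j)" "inw (T i j) = inw a * inw (e j)" if "j \<in> J" for j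
      by (simp_all only: T(2)[OF that] inz_mult inw_mult)
  qed
  then show ?thesis
    by (simp add: zw_zwi)
qed

section \<open>Gauss decomposition\<close>

lemma C_subalg_closed:
  assumes phi: "C_algebra_struct phi"
  shows "0 \<in> C_subalg phi S" "1 \<in> C_subalg phi S"
    "x \<in> C_subalg phi S \<Longrightarrow> - x \<in> C_subalg phi S"
    "x \<in> C_subalg phi S \<Longrightarrow> y \<in> C_subalg phi S \<Longrightarrow> comm x y \<in> C_subalg phi S"
    "(\<And>i. i \<in> I \<Longrightarrow> h i \<in> C_subalg phi S) \<Longrightarrow> sum h I \<in> C_subalg phi S"
proof -
  have 1: "phi 1 = 1" and add: "phi (a + b) = phi a + phi b" for a b
    using phi by (simp_all add: C_algebra_struct_def)
  have 0: "phi 0 = 0"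
    using add[of 0 0] by simp
  have m: "phi (- 1) = - 1"
    using add[of 1 "-1"] 0 1 by (simp add: eq_neg_iff_add_eq_0 add.commute)
  show zero: "0 \<in> C_subalg phi S" and "1 \<in> C_subalg phi S"
    using C_subalg.scal[of phi 0 S] C_subalg.scal[of phi 1 S] by (simp_all add: 0 1)
  show neg: "- x \<in> C_subalg phi S" if "x \<in> C_subalg phi S" for x
    using C_subalg.mult[OF C_subalg.scal[of phi "-1" S] that] by (simp add: m)
  show "comm x y \<in> C_subalg phi S" if "x \<in> C_subalg phi S" "y \<in> C_subalg phi S"
    unfolding comm_def diff_conv_add_uminus
    by (intro C_subalg.add C_subalg.mult neg that)
  show "sum h I \<in> C_subalg phi S" if "\<And>i. i \<in> I \<Longrightarrow> h i \<in> C_subalg phi S"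
    using that by (induction I rule: infinite_finite_induct) (auto intro: zero C_subalg.add)
qed

locale gauss_rtt =
  fixes n :: nat and c :: "nat \<Rightarrow> int"
    and t e f :: "nat \<Rightarrow> nat \<Rightarrow> int \<Rightarrow> 'a::ring_1" and g :: "nat \<Rightarrow> int \<Rightarrow> 'a"
  assumes rels: "RTT_rels n c t e f g"
begin

lemma e_low: "1 \<le> i \<Longrightarrow> i < j \<Longrightarrow> j \<le> n \<Longrightarrow> r \<le> 0 \<Longrightarrow> e i j r = 0"
  and f_low: "1 \<le> i \<Longrightarrow> i < j \<Longrightarrow> j \<le> n \<Longrightarrow> r \<le> 0 \<Longrightarrow> f j i r = 0"
  and g_lead: "i \<in> {1..n} \<Longrightarrow> g i (- c i) = 1"
  and g_low: "i \<in> {1..n} \<Longrightarrow> r < - c i \<Longrightarrow> g i r = 0"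
  and t_eq: "i \<in> {1..n} \<Longrightarrow> j \<in> {1..n} \<Longrightarrow>
       t i j r = (\<Sum>k\<in>{1..min i j}. \<Sum>a\<in>{0..r + c k}. \<Sum>b\<in>{0..r + c k - a}.
                    gauss_F f i k a * g k (r - a - b) * gauss_E e k j b)"
  using rels by (simp_all add: RTT_rels_def)

lemma t_rtt: "i \<in> {1..n} \<Longrightarrow> j \<in> {1..n} \<Longrightarrow> k \<in> {1..n} \<Longrightarrow> l \<in> {1..n} \<Longrightarrow>
       comm (t i j (r+1)) (t k l s) - comm (t i j r) (t k l (s+1)) =
       t k j s * t i l r - t k j r * t i l s"
  using rels unfolding RTT_rels_def by blast

definition es :: "nat \<Rightarrow> nat \<Rightarrow> 'a fls" where "es i j = Abs_fls (e i j)"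
definition fs :: "nat \<Rightarrow> nat \<Rightarrow> 'a fls" where "fs j i = Abs_fls (f j i)"
definition gs :: "nat \<Rightarrow> 'a fls" where "gs i = Abs_fls (g i)"

lemma es_nth: "1 \<le> i \<Longrightarrow> i < j \<Longrightarrow> j \<le> n \<Longrightarrow> es i j $$ r = e i j r"
  and fs_nth: "1 \<le> i \<Longrightarrow> i < j \<Longrightarrow> j \<le> n \<Longrightarrow> fs j i $$ r = f j i r"
  and gs_nth: "k \<in> {1..n} \<Longrightarrow> gs k $$ r = g k r"
  unfolding es_def fs_def gs_def
  by (rule Abs_fls_nth_bound[of 1], simp add: e_low)
    (rule Abs_fls_nth_bound[of 1], simp add: f_low,
     rule Abs_fls_nth_bound[of "- c k"], simp add: g_low)

lemma es_supp: "1 \<le> i \<Longrightarrow> i < j \<Longrightarrow> j \<le> n \<Longrightarrow> neg_supp (es i j)"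
  and fs_supp: "1 \<le> i \<Longrightarrow> i < j \<Longrightarrow> j \<le> n \<Longrightarrow> neg_supp (fs j i)"
  by (simp_all add: neg_supp_def es_nth fs_nth e_low f_low)

definition Es :: "nat \<Rightarrow> nat \<Rightarrow> 'a fls" where
  "Es k j = (if k = j then 1 else if k < j then es k j else 0)"
definition Fs :: "nat \<Rightarrow> nat \<Rightarrow> 'a fls" where
  "Fs i k = (if k = i then 1 else if k < i then fs i k else 0)"

lemma Es_nth: "1 \<le> k \<Longrightarrow> j \<le> n \<Longrightarrow> Es k j $$ r = gauss_E e k j r"
  and Fs_nth: "1 \<le> k \<Longrightarrow> i \<le> n \<Longrightarrow> Fs i k $$ r = gauss_F f i k r"
  by (simp_all add: Es_def Fs_def gauss_E_def gauss_F_def es_nth fs_nth)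

text \<open>\<open>TT m\<close> is the Schur complement obtained from \<open>T(z)\<close> by eliminating the indices below \<open>m\<close>.\<close>

definition TT :: "nat \<Rightarrow> nat \<Rightarrow> nat \<Rightarrow> 'a fls" where
  "TT m i j = (\<Sum>k\<in>{m..min i j}. Fs i k * gs k * Es k j)"

lemma TT_diag: "TT m m m = gs m"
  and TT_row: "m < j \<Longrightarrow> TT m m j = gs m * es m j"
  and TT_col: "m < i \<Longrightarrow> TT m i m = fs i m * gs m"
  by (simp_all add: TT_def Es_def Fs_def)

lemma TT_below: "m < i \<Longrightarrow> m < j \<Longrightarrow> TT m i j = fs i m * gs m * es m j + TT (Suc m) i j"
  unfolding TT_def by (subst sum.atLeast_Suc_atMost) (simp_all add: Es_def Fs_def)

text \<open>The finite ranges of the Gauss relation are the supports: the triangular factors start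
  at exponent 0 and g_k at -c_k.\<close>

lemma TT_nth:
  assumes "i \<in> {1..n}" "j \<in> {1..n}"
  shows "TT 1 i j $$ r = t i j r"
proof -
  have "(Fs i k * gs k * Es k j) $$ r = (\<Sum>a\<in>{0..r + c k}. \<Sum>b\<in>{0..r + c k - a}.
      gauss_F f i k a * g k (r - a - b) * gauss_E e k j b)" if k: "k \<in> {1..min i j}" for k
  proof -
    have k': "k \<in> {1..n}" using that assms by auto
    have F: "Fs i k $$ r = 0" if "r < 0" for r
      using k assms f_low[of k i r] that by (auto simp: Fs_nth gauss_F_def)
    have E: "Es k j $$ r = 0" if "r < 0" for r
      using k assms e_low[of k j r] that by (auto simp: Es_nth gauss_E_def)
    have G: "gs k $$ r = 0" if "r < - c k" for r
      using k' that by (simp add: gs_nth g_low)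
    have GE: "(gs k * Es k j) $$ m = (\<Sum>b\<in>{0..m + c k}. g k (m - b) * gauss_E e k j b)" for m
      using fls_mult_nth_bounds2[of "- c k" "gs k" 0 "Es k j" m] G E k assms
      by (simp add: gs_nth Es_nth)
    have GE0: "(gs k * Es k j) $$ m = 0" if "m < - c k" for m
      unfolding GE using that by simp
    have "(Fs i k * (gs k * Es k j)) $$ r =
        (\<Sum>a\<in>{0..r - - c k}. Fs i k $$ a * (gs k * Es k j) $$ (r - a))"
      by (rule fls_mult_nth_bounds[OF F GE0])
    then show ?thesis
      unfolding GE using k assms
      by (simp add: Fs_nth sum_distrib_left mult.assoc algebra_simps)
  qed
  then show ?thesis
    unfolding TT_def t_eq[OF assms] by (simp add: fls_nth_sum)
qed

lemma gs_unit: "k \<in> {1..n} \<Longrightarrow> \<exists>h. h * gs k = 1 \<and> gs k * h = 1 \<and> (\<forall>s<c k. h $$ s = 0)"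
  by (rule fls_unit[of "gs k" "- c k"]) (auto simp: gs_nth g_lead g_low)

definition hs :: "nat \<Rightarrow> 'a fls" where
  "hs k = (SOME h. h * gs k = 1 \<and> gs k * h = 1 \<and> (\<forall>s<c k. h $$ s = 0))"

lemma hs:
  assumes "k \<in> {1..n}"
  shows "hs k * gs k = 1" "gs k * hs k = 1" "s < c k \<Longrightarrow> hs k $$ s = 0"
  using someI_ex[OF gs_unit[OF assms]] by (auto simp: hs_def)

text \<open>One matrix has to invert every Schur complement on its block, so the induction descends
  from the empty index set, each time bordering the inverse found so far.\<close>

lemma TT_inverse_ex:
  assumes "1 \<le> k" "k \<le> Suc n"
  shows "\<exists>S. \<forall>m\<in>{k..n}. mat_inverse {m..n} (TT m) S"
  using assms(2)
proof (induction rule: inc_induct)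
  case base
  show ?case by simp
next
  case (step m)
  then obtain S' where S': "\<And>q. q \<in> {Suc m..n} \<Longrightarrow> mat_inverse {q..n} (TT q) S'"
    by blast
  have m: "m \<in> {1..n}" using step assms by auto
  have inv: "mat_inverse {Suc m..n} (TT (Suc m)) S'"
  proof (cases "Suc m \<le> n")
    case True
    then show ?thesis using S' by simp
  qed (simp add: mat_inverse_def)
  obtain S where S: "mat_inverse (insert m {Suc m..n}) (TT m) S"
    "\<And>j k. j \<in> {Suc m..n} \<Longrightarrow> k \<in> {Suc m..n} \<Longrightarrow> S j k = S' j k"
  proof (rule mat_inverse_bordered[where T = "TT m" and e = "\<lambda>j. es m j"
          and f = "\<lambda>j. fs j m", OF _ _ inv hs(1,2)[OF m] TT_diag])
    show "TT m m j = gs m * es m j" "TT m j m = fs j m * gs m" if "j \<in> {Suc m..n}" for j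
      using that by (simp_all add: TT_row TT_col)
    show "TT m j k = fs j m * gs m * es m k + TT (Suc m) j k"
      if "j \<in> {Suc m..n}" "k \<in> {Suc m..n}" for j k
      using that by (simp add: TT_below)
  qed auto
  have "mat_inverse {q..n} (TT q) S" if q: "q \<in> {m..n}" for q
  proof (cases "q = m")
    case True
    have "insert m {Suc m..n} = {m..n}" using m by auto
    then show ?thesis using S(1) True by simp
  next
    case False
    then have "q \<in> {Suc m..n}" using q by auto
    then show ?thesis
      using S(2) by (intro mat_inverse_cong[OF S']) auto
  qed
  then show ?case by blast
qed

definition SS :: "nat \<Rightarrow> nat \<Rightarrow> 'a fls" where
  "SS = (SOME S. \<forall>m\<in>{1..n}. mat_inverse {m..n} (TT m) S)"

lemma SS:
  assumes "m \<in> {1..n}"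
  shows "mat_inverse {m..n} (TT m) SS"
proof -
  have "\<exists>S. \<forall>m\<in>{1..n}. mat_inverse {m..n} (TT m) S"
    by (rule TT_inverse_ex) simp_all
  then have "\<forall>m\<in>{1..n}. mat_inverse {m..n} (TT m) SS"
    unfolding SS_def by (rule someI_ex)
  then show ?thesis
    using assms by blast
qed

lemma TT_RTT:
  assumes "m \<in> {1..n}"
  shows "RTT 1 {m..n} (TT m)"
proof -
  have 1: "RTT 1 {1..n} (TT 1)"
    by (rule RTT_coeffI) (simp only: TT_nth t_rtt)
  show ?thesis
    by (rule RTT_below[OF _ _ 1 SS _ SS[OF assms]]) (use assms in \<open>auto simp: zsign_def\<close>)
qed

text \<open>The Gauss sum for (i, j) runs over k \<le> min i j, so the upper left block of T has the
  truncated factors. This makes a chosen index the last one, as \<open>serre_down\<close>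
  requires.\<close>

lemma trunc:
  assumes "m \<le> n"
  shows "RTT_rels m c t e f g"
  unfolding RTT_rels_def
proof (intro conjI ballI allI impI)
  fix i j k l r s assume "i \<in> {1..m}" "j \<in> {1..m}" "k \<in> {1..m}" "l \<in> {1..m}"
  then show "comm (t i j (r + 1)) (t k l s) - comm (t i j r) (t k l (s + 1)) =
      t k j s * t i l r - t k j r * t i l s"
    using assms by (intro t_rtt) auto
next
  fix i j r assume "i \<in> {1..m}" "j \<in> {1..m}"
  then show "t i j r = (\<Sum>k\<in>{1..min i j}. \<Sum>a\<in>{0..r + c k}. \<Sum>b\<in>{0..r + c k - a}.
      gauss_F f i k a * g k (r - a - b) * gauss_E e k j b)"
    using assms by (intro t_eq) auto
next
  fix i j r assume "1 \<le> i" "i < j" "j \<le> m" "r \<le> (0::int)"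
  then show "e i j r = 0" "f j i r = 0"
    using assms by (simp_all add: e_low f_low)
next
  fix i r assume i: "i \<in> {1..m}"
  then show "g i (- c i) = 1"
    using assms by (intro g_lead) auto
  show "g i r = 0" if "r < - c i"
    using assms i that by (intro g_low) auto
qed

lemma op: "RTT_rels n c (\<lambda>i j r. Op (t j i r)) (\<lambda>i j r. Op (f j i r)) (\<lambda>i j r. Op (e j i r)) (\<lambda>i r. Op (g i r))"
  unfolding RTT_rels_def
proof (intro conjI ballI allI impI)
  fix i j k l r s assume I: "i \<in> {1..n}" "j \<in> {1..n}" "k \<in> {1..n}" "l \<in> {1..n}"
  show "comm (Op (t j i (r + 1))) (Op (t l k s)) - comm (Op (t j i r)) (Op (t l k (s + 1))) =
      Op (t j k s) * Op (t l i r) - Op (t j k r) * Op (t l i s)"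
    unfolding comm_Op Op_simps op.inject
    using t_rtt[OF I(2,1,4,3), of r s] by (simp add: comm_swap[of "t l k _"] algebra_simps)
next
  fix i j r assume I: "i \<in> {1..n}" "j \<in> {1..n}"
  have gF: "gauss_F (\<lambda>i j r. Op (e j i r)) i k a = Op (gauss_E e k i a)" for k a
    by (auto simp: gauss_F_def gauss_E_def Op_simps)
  have gE: "gauss_E (\<lambda>i j r. Op (f j i r)) k j a = Op (gauss_F f j k a)" for k a
    by (auto simp: gauss_F_def gauss_E_def Op_simps)
  \<comment> \<open>Reversal exchanges the exponents of the two triangular factors, and the triangle
    a, b \<ge> 0, a + b \<le> r + c_k is symmetric.\<close>
  have sw: "(\<Sum>a\<in>{0..r + c k}. \<Sum>b\<in>{0..r + c k - a}. F a b) =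
      (\<Sum>a\<in>{0..r + c k}. \<Sum>b\<in>{0..r + c k - a}. F b a)" for F :: "int \<Rightarrow> int \<Rightarrow> 'a" and k
    unfolding sum.Sigma[OF finite_atLeastAtMost_int ballI[OF finite_atLeastAtMost_int]]
    by (rule sum.reindex_bij_witness[of _ prod.swap prod.swap]) auto
  show "Op (t j i r) = (\<Sum>k\<in>{1..min i j}. \<Sum>a\<in>{0..r + c k}. \<Sum>b\<in>{0..r + c k - a}.
      gauss_F (\<lambda>i j r. Op (e j i r)) i k a * Op (g k (r - a - b)) * gauss_E (\<lambda>i j r. Op (f j i r)) k j b)"
    unfolding gF gE t_eq[OF I(2,1)] Op_simps Op_sum[symmetric]
    by (subst sw) (simp add: mult.assoc min.commute algebra_simps)
qed (auto simp: e_low f_low g_low g_lead Op_simps)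

section \<open>Drinfeld relations\<close>

lemma inz_hs: "k \<in> {1..n} \<Longrightarrow> inz (hs k) * inz (gs k) = 1"
  "k \<in> {1..n} \<Longrightarrow> inz (gs k) * inz (hs k) = 1"
  and inw_hs: "k \<in> {1..n} \<Longrightarrow> inw (hs k) * inw (gs k) = 1"
  "k \<in> {1..n} \<Longrightarrow> inw (gs k) * inw (hs k) = 1"
  by (simp_all only: inz_mult[symmetric] inw_mult[symmetric] hs inz_1 fls_const_1)

lemma TT_comm_below:
  assumes "1 \<le> q" "q \<le> i" "q \<le> j" "i < m" "j < m" "k \<in> {m..n}" "l \<in> {m..n}"
  shows "comm (inz (TT q i j)) (inw (TT m k l)) = 0"
  by (rule RTT_below_comm[where I = "{q..n}" and J = "{m..n}" and S = SS])
    (use assms TT_RTT[of q] SS[of q] SS[of m] in auto)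

lemma gs_below:
  assumes "1 \<le> q" "q < m" "k \<in> {m..n}" "l \<in> {m..n}"
  shows "comm (inz (gs q)) (inw (TT m k l)) = 0"
  using TT_comm_below[of q q q m k l] assms by (simp add: TT_diag)

text \<open>\<open>gs q\<close> and \<open>gs q * es q (q + 1)\<close> are entries of
  \<open>TT q\<close> with indices below m, so both commute with \<open>TT m\<close>; the invertible
  factor is then removed.\<close>

lemma es_below:
  assumes "1 \<le> q" "q + 1 < m" "k \<in> {m..n}" "l \<in> {m..n}"
  shows "comm (inz (es q (q + 1))) (inw (TT m k l)) = 0"
proof -
  have q: "q \<in> {1..n}" using assms by auto
  have 1: "comm (inw (TT m k l)) (inz (gs q)) = 0"
    using gs_below[of q m k l] assms by (simp add: comm_swap[of "inw _"])
  have 2: "comm (inw (TT m k l)) (inz (gs q) * inz (es q (q + 1))) = 0"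
    using TT_comm_below[of q q "q + 1" m k l] assms
    by (simp add: TT_row inz_mult comm_swap[of "inw _"])
  show ?thesis
    using comm_left_unit_0[OF 1 2 inz_hs(1)[OF q]] by (simp add: comm_swap[of "inz _"])
qed

lemma comm_TT_entries:
  assumes "m \<in> {1..n}" and X: "\<And>k l. k \<in> {m..n} \<Longrightarrow> l \<in> {m..n} \<Longrightarrow> comm X (inw (TT m k l)) = 0"
  shows "comm X (inw (gs m)) = 0"
    "j \<in> {m<..n} \<Longrightarrow> comm X (inw (es m j)) = 0"
    "j \<in> {m<..n} \<Longrightarrow> comm X (inw (fs j m)) = 0"
proof -
  show 1: "comm X (inw (gs m)) = 0"
    using X[of m m] assms(1) by (simp add: TT_diag)
  show "comm X (inw (es m j)) = 0" if "j \<in> {m<..n}"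
    by (rule comm_left_unit_0[OF 1 _ inw_hs(1)[OF assms(1)]])
      (use X[of m j] that in \<open>simp add: TT_row inw_mult del: fls_const_mult_const\<close>)
  show "comm X (inw (fs j m)) = 0" if "j \<in> {m<..n}"
    by (rule comm_right_unit_0[OF 1 _ inw_hs(2)[OF assms(1)]])
      (use X[of j m] that in \<open>simp add: TT_col inw_mult del: fls_const_mult_const\<close>)
qed

lemma g_comm:
  assumes "i \<in> {1..n}" "j \<in> {1..n}"
  shows "comm (g i r) (g j s) = 0"
proof -
  have lt: "comm (g i r) (g j s) = 0" if "1 \<le> i" "i < j" "j \<le> n" for i j r s
  proof -
    have "comm (inz (gs i)) (inw (gs j)) = 0"
      by (rule comm_TT_entries(1)) (use that gs_below in auto)
    then show ?thesis
      using comm_cf[of "gs i" "gs j" r s] that by (simp add: gs_nth)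
  qed
  have eq: "comm (g i r) (g i s) = 0"
    using RTT_diag[OF TT_RTT[OF assms(1)], of i] assms(1) comm_cf[of "gs i" "gs i" r s]
    by (simp add: TT_diag gs_nth)
  consider "i < j" | "i = j" | "j < i" by linarith
  then show ?thesis
    using lt[of i j r s] lt[of j i s r] eq assms
    by cases (auto simp: comm_swap[of "g i r"])
qed

section \<open>Relations within a row and between neighbouring rows\<close>

lemma row_facts:
  assumes i: "1 \<le> i" and jl: "j \<in> {i<..n}" "l \<in> {i<..n}"
  shows "zw * comm (inz (gs i)) (inw (es i j)) = inz (gs i) * (inz (es i j) - inw (es i j))"
    "zw * comm (inz (es i j)) (inw (es i l)) =
      - ((inz (es i j) - inw (es i j)) * (inz (es i l) - inw (es i l)))"
    "comm (e i j r) (e i l s) + comm (e i j s) (e i l r) = 0"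
proof -
  have z: "zsign 1" by (simp add: zsign_def)
  note R = RTT_row[OF z TT_RTT[of i], of i j l "gs i" "es i j" "es i l" "hs i"]
  note R = R[OF _ _ _ _ TT_diag TT_row TT_row hs(1) es_supp es_supp]
  show "zw * comm (inz (gs i)) (inw (es i j)) = inz (gs i) * (inz (es i j) - inw (es i j))"
    by (subst R(2)) (use assms in \<open>auto simp: zw_zwi\<close>)
  have "1 * (zw * comm (inz (es i j)) (inw (es i l))) =
      - ((inz (es i j) - inw (es i j)) * (inz (es i l) - inw (es i l)))"
    by (rule R(3)) (use assms in auto)
  then show "zw * comm (inz (es i j)) (inw (es i l)) =
      - ((inz (es i j) - inw (es i j)) * (inz (es i l) - inw (es i l)))"
    by simp
  have "comm (es i j $$ r) (es i l $$ s) + comm (es i j $$ s) (es i l $$ r) = 0"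
    by (rule R(4)) (use assms in auto)
  then show "comm (e i j r) (e i l s) + comm (e i j s) (e i l r) = 0"
    using assms by (simp add: es_nth)
qed

lemma g_e_step:
  assumes "1 \<le> i" "j \<in> {i<..n}" "s \<ge> 1"
  shows "comm (g i (r + 1)) (e i j s) = comm (g i r) (e i j (s + 1)) - g i r * e i j s"
  using zw_comm_cf[OF row_facts(1)[OF assms(1,2,2)], of r s] assms
  by (simp add: right_diff_distrib cf_mult_inz_inz cf_inz es_nth gs_nth diff_eq_eq algebra_simps)

lemma row_below_facts:
  assumes i: "1 \<le> i" and j: "j \<in> {i<..n}" and kl: "k \<in> {i<..n}" "l \<in> {i<..n}"
  shows "zw * comm (inz (es i j)) (inw (TT (Suc i) k l)) =
    inw (TT (Suc i) k j) * (inz (es i l) - inw (es i l))"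
proof (rule RTT_row_below[where J = "{Suc i..n}" and i = i and T = "TT i" and S = SS])
  have "insert i {Suc i..n} = {i..n}"
    using i j by auto
  then show "RTT 1 (insert i {Suc i..n}) (TT i)" "mat_inverse (insert i {Suc i..n}) (TT i) SS"
    using i j by (simp_all add: TT_RTT SS)
  show "mat_inverse {Suc i..n} (TT (Suc i)) SS"
    using i j by (intro SS) auto
  show "TT i i i = gs i" "hs i * gs i = 1"
    using i j by (auto simp: TT_diag hs)
  show "TT i i j = gs i * es i j" if "j \<in> {Suc i..n}" for j
    using that by (simp add: TT_row)
qed (use assms in auto)

lemma e_g_next:
  assumes "1 \<le> i" "i + 1 \<le> n" "r \<ge> 1"
  shows "comm (g (i + 1) (s + 1)) (e i (i + 1) r) =
    comm (g (i + 1) s) (e i (i + 1) (r + 1)) + g (i + 1) s * e i (i + 1) r"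
proof -
  have "zw * comm (inz (es i (i + 1))) (inw (gs (i + 1))) =
      inw (gs (i + 1)) * (inz (es i (i + 1)) - inw (es i (i + 1)))"
    using row_below_facts[of i "i + 1" "i + 1" "i + 1"] assms by (simp add: TT_diag)
  from zw_comm_cf[OF this, of r s] show ?thesis
    using assms
    by (simp add: right_diff_distrib cf_mult_inw_inw cf_inw es_nth gs_nth
        comm_swap[of "g _ _"] algebra_simps)
qed

text \<open>Row i + 1 of the next Schur complement is b(1, v). The commutators of x with b and with
  b v are both known, so the product rule yields the one with v after b is cancelled.\<close>

lemma e_e_next:
  assumes i: "1 \<le> i" and l: "l \<in> {i + 1<..n}"
  shows "zw * comm (inz (es i (i + 1))) (inw (es (i + 1) l)) =
    inz (es i l) - inw (es i l) - (inz (es i (i + 1)) - inw (es i (i + 1))) * inw (es (i + 1) l)"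
proof -
  let ?b = "inw (gs (i + 1))" and ?x = "inz (es i (i + 1))" and ?v = "inw (es (i + 1) l)"
  have 1: "zw * comm ?x ?b = ?b * (?x - inw (es i (i + 1)))"
    using row_below_facts[of i "i + 1" "i + 1" "i + 1"] i l by (simp add: TT_diag)
  have 2: "zw * comm ?x (?b * ?v) = ?b * (inz (es i l) - inw (es i l))"
    using row_below_facts[of i "i + 1" "i + 1" l] i l
    by (simp add: TT_diag TT_row inw_mult del: fls_const_mult_const)
  have "?b * (zw * comm ?x ?v) = zw * comm ?x (?b * ?v) - (zw * comm ?x ?b) * ?v"
    unfolding comm_mult zw_central by (simp add: algebra_simps) (simp flip: mult.assoc zw_central)
  also have "\<dots> = ?b * (inz (es i l) - inw (es i l) - (?x - inw (es i (i + 1))) * ?v)"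
    unfolding 1 2 by (simp only: right_diff_distrib left_diff_distrib mult.assoc)
  finally have "inw (hs (i + 1)) * ?b * (zw * comm ?x ?v) = inw (hs (i + 1)) * ?b *
      (inz (es i l) - inw (es i l) - (?x - inw (es i (i + 1))) * ?v)"
    by (simp only: mult.assoc)
  moreover have "inw (hs (i + 1)) * ?b = 1"
    using i l by (intro inw_hs) auto
  ultimately show ?thesis
    by (simp only: mult_1_left)
qed

text \<open>The boundary terms matter: for r, s \<ge> 1 they vanish and leave Y6; s = 0 expresses
  e_{i,l} by commutators; r = 0 with l = i + 2 produces an entry of the inverse of E(z).\<close>

lemma e_e_next_nth:
  assumes i: "1 \<le> i" and l: "l \<in> {i + 1<..n}"
  shows "comm (e i (i + 1) (r + 1)) (e (i + 1) l s) - comm (e i (i + 1) r) (e (i + 1) l (s + 1)) =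
     (if s = 0 then e i l r else 0) - (if r = 0 then e i l s else 0)
     - e i (i + 1) r * e (i + 1) l s + (if r = 0 then (es i (i + 1) * es (i + 1) l) $$ s else 0)"
  using zw_comm_cf[OF e_e_next[OF assms], of r s] assms
  by (simp add: left_diff_distrib cf_mult_inw_inw cf_inz cf_inw es_nth del: fls_const_mult_const)

lemma e_gen:
  assumes "1 \<le> i" "l \<in> {i + 1<..n}" "r \<ge> 1"
  shows "e i l r = - comm (e i (i + 1) r) (e (i + 1) l 1)"
  using e_e_next_nth[OF assms(1,2), of r 0] assms by (simp add: e_low)

lemma Y6:
  assumes "1 \<le> i" "i + 1 < n" "r \<ge> 1" "s \<ge> 1"
  shows "comm (e i (i + 1) (r + 1)) (e (i + 1) (i + 1 + 1) s) -
      comm (e i (i + 1) r) (e (i + 1) (i + 1 + 1) (s + 1)) =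
    - (e i (i + 1) r * e (i + 1) (i + 1 + 1) s)"
  using e_e_next_nth[of i "i + 1 + 1" r s] assms by simp

text \<open>Column i + 1 of the next Schur complement contains b and f b. The formulas for [x, b]
  and [x, f b] differ only by the left factor f, so [x, f] b = 0.\<close>

lemma e_f_next:
  assumes "1 \<le> i" "i + 1 < n"
  shows "comm (inz (es i (i + 1))) (inw (fs (i + 1 + 1) (i + 1))) = 0"
proof -
  let ?b = "inw (gs (i + 1))" and ?x = "inz (es i (i + 1))" and ?f = "inw (fs (i + 1 + 1) (i + 1))"
  have 1: "zw * comm ?x ?b = ?b * (?x - inw (es i (i + 1)))"
    using row_below_facts[of i "i + 1" "i + 1" "i + 1"] assms by (simp add: TT_diag)
  have 2: "zw * comm ?x (?f * ?b) = ?f * ?b * (?x - inw (es i (i + 1)))"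
    using row_below_facts[of i "i + 1" "i + 1 + 1" "i + 1"] assms
    by (simp add: TT_diag TT_col inw_mult del: fls_const_mult_const)
  have "zw * (comm ?x ?f * ?b) = zw * comm ?x (?f * ?b) - ?f * (zw * comm ?x ?b)"
    unfolding comm_mult by (simp add: algebra_simps zw_central)
  then have "zw * (comm ?x ?f * ?b) = zw * 0"
    unfolding 1 2 by (simp add: mult.assoc del: fls_const_mult_const)
  then have "comm ?x ?f * ?b = 0"
    by (rule zw_cancel)
  then have "comm ?x ?f * (?b * inw (hs (i + 1))) = 0"
    by (simp only: mult.assoc[symmetric]) simp
  moreover have "?b * inw (hs (i + 1)) = 1"
    using assms by (intro inw_hs) auto
  ultimately show ?thesis
    by (simp only: mult_1_right)
qed

section \<open>Distant coordinates, Cartan relations and quadratic relations\<close>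

lemma Y1_off:
  assumes "1 \<le> i" "i < j" "j < n"
  shows "comm (e i (i + 1) r) (f (j + 1) j s) = 0"
proof -
  have "comm (inz (es i (i + 1))) (inw (fs (j + 1) j)) = 0"
  proof (cases "j = i + 1")
    case True
    then show ?thesis using e_f_next[of i] assms by simp
  next
    case False
    show ?thesis
      by (rule comm_TT_entries(3)) (use assms False es_below[of i j] in auto)
  qed
  then show ?thesis
    using comm_cf[of "es i (i + 1)" "fs (j + 1) j" r s] assms by (simp add: es_nth fs_nth)
qed

lemma Y8:
  assumes "1 \<le> i" "i + 1 < j" "j < n"
  shows "comm (e i (i + 1) r) (e j (j + 1) s) = 0"
proof -
  have "comm (inz (es i (i + 1))) (inw (es j (j + 1))) = 0"
    by (rule comm_TT_entries(2)) (use assms es_below[of i j] in auto)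
  then show ?thesis
    using comm_cf[of "es i (i + 1)" "es j (j + 1)" r s] assms by (simp add: es_nth)
qed

lemma g_e_low:
  assumes "1 \<le> i" "i < j" "j < n"
  shows "comm (g i r) (e j (j + 1) s) = 0"
proof -
  have "comm (inz (gs i)) (inw (es j (j + 1))) = 0"
    by (rule comm_TT_entries(2)) (use assms in \<open>auto intro!: gs_below\<close>)
  then show ?thesis
    using comm_cf[of "gs i" "es j (j + 1)" r s] assms by (simp add: es_nth gs_nth)
qed

lemma g_e_high:
  assumes "1 \<le> j" "j + 1 < i" "i \<le> n"
  shows "comm (g i r) (e j (j + 1) s) = 0"
proof -
  have "comm (inz (es j (j + 1))) (inw (gs i)) = 0"
    by (rule comm_TT_entries(1)) (use assms es_below[of j i] in auto)
  then show ?thesis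
    using comm_cf[of "es j (j + 1)" "gs i" s r] assms
    by (simp add: es_nth gs_nth comm_swap[of "g _ _"])
qed

text \<open>For i = j and i = j + 1 the two-variable relations are recursions in r, started at the
  leading coefficient 1 of g_i; for all other i the coordinates commute.\<close>

lemma Y2:
  assumes i: "i \<in> {1..n}" and j: "j \<in> {1..<n}" and rs: "r \<ge> - c i" "s \<ge> 1"
  shows "comm (g i r) (e j (j + 1) s) = (kd i (j + 1) - kd i j) *
    (\<Sum>u\<in>{- c i..r - 1}. g i u * e j (j + 1) (r + s - u - 1))"
proof -
  consider "i < j" | "i = j" | "i = j + 1" | "j + 1 < i" by linarith
  then show ?thesis
  proof cases
    case 1
    then show ?thesis using i j g_e_low[of i j r s] by (simp add: kd_def)
  next
    case 2
    have "comm (g i r) (e i (i + 1) s) =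
        (\<Sum>u\<in>{- c i..r - 1}. - (g i u * e i (i + 1) (r + s - u - 1)))"
      by (rule commutator_recursion[where C = "\<lambda>r s. comm (g i r) (e i (i + 1) s)"
            and P = "\<lambda>u v. - (g i u * e i (i + 1) v)", OF _ _ rs])
        (use i j 2 in \<open>simp_all add: g_e_step g_lead\<close>)
    then show ?thesis
      by (simp add: 2 kd_def sum_negf)
  next
    case 3
    have "comm (g i r) (e j (j + 1) s) =
        (\<Sum>u\<in>{- c i..r - 1}. g i u * e j (j + 1) (r + s - u - 1))"
      by (rule commutator_recursion[where C = "\<lambda>r s. comm (g i r) (e j (j + 1) s)"
            and P = "\<lambda>u v. g i u * e j (j + 1) v", OF _ _ rs])
        (use i j 3 e_g_next[of j] in \<open>simp_all add: g_lead\<close>)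
    then show ?thesis
      by (simp add: 3 kd_def)
  next
    case 4
    then show ?thesis using i j g_e_high[of j i r s] by (simp add: kd_def)
  qed
qed

lemma Y4:
  assumes i: "i \<in> {1..<n}" and rs: "r \<ge> 1" "s \<ge> 1"
  shows "comm (e i (i + 1) r) (e i (i + 1) s) =
    (\<Sum>u\<in>{1..r - 1}. e i (i + 1) u * e i (i + 1) (r + s - u - 1)) -
    (\<Sum>u\<in>{1..s - 1}. e i (i + 1) u * e i (i + 1) (r + s - u - 1))"
proof -
  let ?x = "e i (i + 1)"
  have supp: "es i (i + 1) $$ r = 0" if "r < 1" for r
    using es_supp[of i "i + 1"] i that by (simp add: neg_supp_def)
  have row: "zw * comm (inz (es i (i + 1))) (inw (es i (i + 1))) =
      - ((inz (es i (i + 1)) - inw (es i (i + 1))) * (inz (es i (i + 1)) - inw (es i (i + 1))))"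
    by (rule row_facts(2)) (use i in auto)
  note step = zw_comm_cf[OF row, unfolded cf_simps cf_diff_mult]
  \<comment> \<open>At r = 0 only the one-variable square of the series survives, whose convolution
    sum runs from 1 to s - 1.\<close>
  have first: "comm (?x 1) (?x s) = - (\<Sum>u\<in>{1..s - 1}. ?x u * ?x (s - u))" if "s \<ge> 1" for s
    using step[of 0 s] that i fls_mult_nth_bounds[where a = 1 and b = 1, OF supp supp, of s]
    by (simp add: es_nth e_low)
  \<comment> \<open>From (r, s + 1) to (r + 1, s), the first product lengthens the first sum and the
    second product shortens the subtracted one.\<close>
  have rec: "comm (?x (r + 1)) (?x s) = comm (?x r) (?x (s + 1)) + (?x r * ?x s + ?x s * ?x r)"
    if "r \<ge> 1" "s \<ge> 1" for r s
    using step[of r s] that i by (simp add: es_nth diff_eq_eq algebra_simps)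
  show ?thesis
    using rs
  proof (induction r arbitrary: s rule: int_ge_induct)
    case base
    then show ?case using first[of s] by simp
  next
    case (step r)
    have 1: "{1..r + 1 - 1} = insert r {1..r - 1}" "{1..s + 1 - 1} = insert s {1..s - 1}"
      using step.hyps step.prems by auto
    have 2: "(\<Sum>u\<in>{1..r + 1 - 1}. ?x u * ?x (r + 1 + s - u - 1)) =
        ?x r * ?x s + (\<Sum>u\<in>{1..r - 1}. ?x u * ?x (r + (s + 1) - u - 1))"
      unfolding 1(1) by (subst sum.insert) (simp_all add: algebra_simps)
    have 3: "(\<Sum>u\<in>{1..s + 1 - 1}. ?x u * ?x (r + (s + 1) - u - 1)) =
        ?x s * ?x r + (\<Sum>u\<in>{1..s - 1}. ?x u * ?x (r + 1 + s - u - 1))"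
      unfolding 1(2) by (subst sum.insert) (simp_all add: algebra_simps)
    have "comm (?x r) (?x (s + 1)) =
        (\<Sum>u\<in>{1..r - 1}. ?x u * ?x (r + (s + 1) - u - 1)) -
        (\<Sum>u\<in>{1..s + 1 - 1}. ?x u * ?x (r + (s + 1) - u - 1))"
      using step.prems by (intro step.IH) simp
    then show ?case
      unfolding 2 3 rec[OF step.hyps step.prems] by simp
  qed
qed

section \<open>Commutators of e with f\<close>

lemma upper_lower:
  assumes i: "1 \<le> i" "i < n"
  shows "zw * comm (inz (es i (i + 1))) (inw (fs (i + 1) i)) =
    inw (gs (i + 1) * hs i) - inz (hs i * gs (i + 1))"
proof -
  let ?j = "i + 1"
  define a e' f' d where "a = gs i" and "e' = es i ?j" and "f' = fs ?j i" and "d = gs ?j"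
  have z: "zsign 1" by (simp add: zsign_def)
  interpret r: rtt_pair "1 * zwi" "1 * zw"
    by (rule zsign_rtt_pair[OF z])
  interpret m: rtt_pair "-1 * zwi" "-1 * zw"
    by (rule zsign_rtt_pair) (simp add: zsign_def)
  have ij: "i \<in> {i..n}" "?j \<in> {i..n}" and iN: "i \<in> {1..n}" using i by auto
  have T: "TT i i i = a" "TT i i ?j = a * e'" "TT i ?j i = f' * a" "TT i ?j ?j = d + f' * a * e'"
    by (simp_all add: a_def e'_def f'_def d_def TT_diag TT_row TT_col TT_below)
  note R = TT_RTT[OF iN]
  have u: "hs i * a = 1" "a * hs i = 1"
    unfolding a_def using hs(1,2)[OF iN] .
  have supp: "neg_supp e'" "neg_supp f'"
    unfolding e'_def f'_def using i by (auto intro: es_supp fs_supp)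
  note row = RTT_row[OF z R ij(1,2,2) T(1,2,2) u(1) supp(1,1)]
  note col = RTT_col[OF z R ij(1,2,2) T(1,3,3) u(2) supp(2,2)]
  have ad: "comm (a $$ r) (d $$ s) = 0" for r s
    using g_comm[of i ?j r s] i by (simp add: a_def d_def gs_nth)
  have Q: "comm (inz (TT i i ?j)) (inw (TT i ?j i)) =
      zwi * (inw (TT i ?j ?j) * inz (TT i i i) - inz (TT i ?j ?j) * inw (TT i i i))"
    using R ij by (simp add: RTT_def rtt_def)
  \<comment> \<open>Here w comes first, so the second half of \<open>RTT\<close> is used, with its
    opposite sign.\<close>
  have e2: "comm (inw a) (inz e') = - (1 * zwi * (inw a * (inw e' - inz e')))"
  proof -
    have c: "comm (inw a) (inz a) = 0"
      using row(1) by (simp add: comm_swap[of "inw a"])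
    have R2: "comm (inw (TT i i i)) (inz (TT i i ?j)) =
        - zwi * (inz (TT i i i) * inw (TT i i ?j) - inw (TT i i i) * inz (TT i i ?j))"
      using R ij by (simp add: RTT_def rtt_def)
    have "comm (inw a) (inz a * inz e') =
        -1 * zwi * (inz a * (inw a * inw e') - inw a * (inz a * inz e'))"
      using R2 unfolding T inz_mult inw_mult by simp
    moreover have "inz (hs i) * inz a = 1"
      by (simp only: inz_mult[symmetric] u inz_1)
    ultimately have "comm (inw a) (inz e') = -1 * zwi * (inw a * (inw e' - inz e'))"
      by (rule m.row_linear[OF c])
    then show ?thesis by (simp only: mult_minus_left mult_1_left)
  qed
  have "comm (inz e') (inw f') = 1 * zwi * (inw d * inw (hs i) - inz (hs i) * inz d)"
  proof (rule r.upper_lower_relation[OF row(1) _ _ col(1) row(2) e2])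
    show "comm (inz a) (inw d) = 0" "comm (inw a) (inz d) = 0"
      using comm_series[OF ad] by auto
    show "comm (inz a * inz e') (inw f' * inw a) = 1 * zwi *
        ((inw d + inw f' * inw a * inw e') * inz a - (inz d + inz f' * inz a * inz e') * inw a)"
      using Q unfolding T by (simp only: inz_mult inw_mult inz_add fls_plus_const[symmetric] mult_1_left)
    show "inz (hs i) * inz a = 1" "inw a * inw (hs i) = 1"
      by (simp_all only: inz_mult[symmetric] inw_mult[symmetric] u inz_1 fls_const_1)
  qed
  then show ?thesis
    unfolding e'_def f'_def d_def by (simp only: mult_1_left zw_zwi inz_mult inw_mult)
qed

text \<open>The right side of \<open>upper_lower\<close> has coefficients only on the axes r = 0 and
  s = 0. Hence for r, s \<ge> 1 the commutator depends on r + s alone, and the coefficient at r = 0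
  gives its value.\<close>

lemma Y1_diag:
  assumes i: "1 \<le> i" "i < n" and rs: "r \<ge> 1" "s \<ge> 1"
  shows "comm (e i (i + 1) r) (f (i + 1) i s) = (hs i * gs (i + 1)) $$ (r + s - 1)"
proof -
  have iN: "i \<in> {1..n}" "i + 1 \<in> {1..n}" using i by auto
  have "comm (gs (i + 1)) (gs i) = 0"
    by (rule comm_series(1)) (simp only: gs_nth iN g_comm)
  then have "comm (gs (i + 1)) (hs i) = 0"
    by (rule comm_unit_0[OF _ hs(1,2)[OF iN(1)]])
  then have h: "gs (i + 1) * hs i = hs i * gs (i + 1)"
    by (simp add: comm_def)
  have rec: "comm (es i (i + 1) $$ (r + 1)) (fs (i + 1) i $$ s) -
      comm (es i (i + 1) $$ r) (fs (i + 1) i $$ (s + 1)) =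
      (if r = 0 then (hs i * gs (i + 1)) $$ s else 0) - (if s = 0 then (hs i * gs (i + 1)) $$ r else 0)"
    for r s
    using zw_comm_cf[OF upper_lower[OF i], of r s] unfolding h cf_simps cf_inw cf_inz .
  show ?thesis
    using rs
  proof (induction r arbitrary: s rule: int_ge_induct)
    case base
    then show ?case
      using rec[of 0 s] i by (simp add: es_nth fs_nth e_low cf_inw cf_inz)
  next
    case (step r)
    then show ?case
      using rec[of r s] i
      by (simp add: es_nth fs_nth cf_inw cf_inz algebra_simps)
  qed
qed

section \<open>Serre relations\<close>

lemma g_e_next_leading:
  assumes "1 \<le> j" "j + 1 \<le> n" "r \<ge> 1"
  shows "comm (g (j + 1) (- c (j + 1) + 2)) (e j (j + 1) r) =
    e j (j + 1) (r + 1) + g (j + 1) (- c (j + 1) + 1) * e j (j + 1) r"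
proof -
  \<comment> \<open>The coefficient next to the leading one fixes each e-coefficient, so -c + 2 is
    the first index at which commuting raises r.\<close>
  have "comm (g (j + 1) (- c (j + 1) + 1)) (e j (j + 1) r') = e j (j + 1) r'" if "r' \<ge> 1" for r'
    using e_g_next[of j r' "- c (j + 1)"] assms that by (simp add: g_lead)
  then show ?thesis
    using e_g_next[of j r "- c (j + 1) + 1"] assms by (simp add: algebra_simps)
qed

lemma g_e_leading:
  assumes "1 \<le> i" "i < n" "r \<ge> 1"
  shows "comm (g i (- c i + 2)) (e i (i + 1) r) =
    - (e i (i + 1) (r + 1) + g i (- c i + 1) * e i (i + 1) r)"
proof -
  have "comm (g i (- c i + 1)) (e i (i + 1) r') = - e i (i + 1) r'" if "r' \<ge> 1" for r'
    using g_e_step[of i "i + 1" r' "- c i"] assms that by (simp add: g_lead)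
  then show ?thesis
    using g_e_step[of i "i + 1" r "- c i + 1"] assms by (simp add: algebra_simps)
qed

text \<open>For u = 1 the inner commutators are coefficients of - e_{i,i+2}, and the antisymmetry
  within row i applies. The coefficient raising u is taken from g_{i+2}, which commutes with
  e_i.\<close>

lemma serre_up:
  assumes i: "1 \<le> i" "i + 1 < n" and rst: "r \<ge> 1" "s \<ge> 1" "u \<ge> 1"
  shows "serre (e i (i + 1) r) (e i (i + 1) s) (e (i + 1) (i + 1 + 1) u) = 0"
  using rst(3)
proof (induction u rule: int_ge_induct)
  case base
  have "comm (e i (i + 1) r') (e (i + 1) (i + 1 + 1) 1) = - e i (i + 1 + 1) r'" if "r' \<ge> 1" for r'
    using e_gen[of i "i + 1 + 1" r'] i that by simp
  then show ?case
    using row_facts(3)[of i "i + 1" "i + 1 + 1" r s] i rst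
    unfolding serre_def by (simp add: neg_eq_iff_add_eq_0 flip: minus_add)
next
  case (step u)
  show ?case
    by (rule serre_shift[OF step.IH, where A = "g (i + 1 + 1) (- c (i + 1 + 1) + 2)"
          and B = "g (i + 1 + 1) (- c (i + 1 + 1) + 1)"])
      (use i step.hyps g_e_next_leading[of "i + 1" u] g_e_high[of i "i + 1 + 1"] in auto)
qed

text \<open>Back substitution in T S = 1. As F is lower unitriangular, the last column of the
  inverse is that of the inverse of E, times \<open>hs n\<close>.\<close>

lemma inverse_entries:
  assumes n: "n = i + 1 + 1" and i: "1 \<le> i"
  shows "SS n n = hs n" "SS (i + 1) n = - es (i + 1) n * hs n"
    "SS i n = (es i (i + 1) * es (i + 1) n - es i n) * hs n"
proof -
  have cancel: "x = y" if "k \<in> {1..n}" "gs k * x = gs k * y" for k x y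
  proof -
    have "(hs k * gs k) * x = (hs k * gs k) * y"
      using that(2) by (simp only: mult.assoc)
    then show ?thesis using hs(1)[OF that(1)] by simp
  qed
  show 1: "SS n n = hs n"
  proof (rule cancel[of n])
    show "gs n * SS n n = gs n * hs n"
      using mat_inverseD(1)[OF SS[of n], of n n] n by (simp add: TT_diag kd_def hs)
  qed (simp add: n)
  have two: "{i + 1..n} = {i + 1, n}" and three: "{i..n} = {i, i + 1, n}"
    using n by auto
  show 2: "SS (i + 1) n = - es (i + 1) n * hs n"
  proof (rule cancel[of "i + 1"])
    have "gs (i + 1) * SS (i + 1) n + gs (i + 1) * es (i + 1) n * hs n = 0"
      using mat_inverseD(1)[OF SS[of "i + 1"], of "i + 1" n] n 1 unfolding two
      by (simp add: TT_diag TT_row kd_def)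
    then show "gs (i + 1) * SS (i + 1) n = gs (i + 1) * (- es (i + 1) n * hs n)"
      by (simp add: eq_neg_iff_add_eq_0 mult.assoc)
  qed (use i n in auto)
  show "SS i n = (es i (i + 1) * es (i + 1) n - es i n) * hs n"
  proof (rule cancel[of i])
    have "gs i * SS i n + (gs i * es i (i + 1) * (- es (i + 1) n * hs n) + gs i * es i n * hs n) = 0"
      using mat_inverseD(1)[OF SS[of i], of i n] n i 1 2 unfolding three
      by (simp add: TT_diag TT_row kd_def)
    then show "gs i * SS i n = gs i * ((es i (i + 1) * es (i + 1) n - es i n) * hs n)"
      by (simp add: algebra_simps add_eq_0_iff)
  qed (use i n in auto)
qed

text \<open>The repeated generator has the larger index, so the last column of the inverse replaces
  a row of T. Its entries, divided by \<open>hs n\<close>, include -v and X, and up to sign the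
  coefficients of X are commutators of those of v with e_i^(1). To raise u, g_i is used, which
  commutes with e_{i+1}.\<close>

lemma serre_down_last:
  assumes n: "n = i + 1 + 1" and i: "1 \<le> i" and rst: "r \<ge> 1" "s \<ge> 1" "u \<ge> 1"
  shows "serre (e (i + 1) n r) (e (i + 1) n s) (e i (i + 1) u) = 0"
  using rst(3)
proof (induction u rule: int_ge_induct)
  case base
  define v X where "v = es (i + 1) n" and "X = es i (i + 1) * es (i + 1) n - es i n"
  have supp: "neg_supp v" "neg_supp X"
  proof -
    have *: "neg_supp (es i (i + 1))" "neg_supp (es (i + 1) n)" "neg_supp (es i n)"
      using i n by (auto intro: es_supp)
    show "neg_supp v" unfolding v_def by (rule *)
    show "neg_supp X"
      unfolding X_def using neg_supp_mult[OF *(1,2)] *(3) by (simp add: neg_supp_def)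
  qed
  have "RTT (- 1) {i..n} SS"
    by (rule RTT_inverse[OF _ _ TT_RTT SS]) (use i n in \<open>auto simp: zsign_def\<close>)
  then have "comm ((- v) $$ r) (X $$ s) + comm ((- v) $$ s) (X $$ r) = 0"
    by (rule RTT_col(2)[where i = n and j = "i + 1" and l = i and a = "hs n" and h = "gs n", rotated])
      (use inverse_entries[OF n i] supp i n in \<open>auto simp: zsign_def hs neg_supp_def v_def X_def\<close>)
  then have 1: "comm (v $$ r) (X $$ s) + comm (v $$ s) (X $$ r) = 0"
    by (simp add: neg_eq_iff_add_eq_0 flip: minus_add)
  have X: "comm (e (i + 1) n r') (e i (i + 1) 1) = - (X $$ r')" if "r' \<ge> 1" for r'
    using e_e_next_nth[OF i, of n 0 r'] i n that
    by (simp add: X_def es_nth e_low comm_swap[of "e (Suc i) _ _"])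
  have v: "v $$ r' = e (i + 1) n r'" for r'
    using n by (simp add: v_def es_nth)
  show ?case
    using 1 unfolding serre_def v X[OF rst(1)] X[OF rst(2)] comm_uminus minus_add_distrib[symmetric]
    by simp
next
  case (step u)
  show ?case
    by (rule serre_shift[OF step.IH, where A = "g i (- c i + 2)" and B = "g i (- c i + 1)"])
      (use i n step.hyps g_e_leading[of i u] g_e_low[of i "i + 1"] in auto)
qed

lemma serre_down:
  assumes i: "1 \<le> i" "i + 1 < n" and rst: "r \<ge> 1" "s \<ge> 1" "u \<ge> 1"
  shows "serre (e (i + 1) (i + 1 + 1) r) (e (i + 1) (i + 1 + 1) s) (e i (i + 1) u) = 0"
proof -
  interpret T: gauss_rtt "i + 1 + 1" c t e f g
    by unfold_locales (rule trunc, use i in simp)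
  show ?thesis
    by (rule T.serre_down_last[OF refl i(1) rst])
qed

lemma Y10:
  assumes ij: "i \<in> {1..<n}" "j \<in> {1..<n}" "i + 1 = j \<or> j + 1 = i"
    and rst: "r \<ge> 1" "s \<ge> 1" "u \<ge> 1"
  shows "serre (e i (i + 1) r) (e i (i + 1) s) (e j (j + 1) u) = 0"
  using ij(3)
proof
  assume "i + 1 = j"
  then show ?thesis using serre_up[of i r s u] ij rst by auto
next
  assume "j + 1 = i"
  then show ?thesis using serre_down[of j r s u] ij rst by auto
qed

section \<open>The series of the D tilde\<close>

definition dt :: "nat \<Rightarrow> int \<Rightarrow> 'a" where
  "dt i s = (if i \<in> {1..n} \<and> c i \<le> s then - (hs i $$ s) else 0)"

text \<open>\<open>hs i\<close> vanishes below \<open>c i\<close>, so the default 0 of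
  \<open>dt\<close> agrees with it there; the minus sign comes from the -1 in Y0.\<close>

lemma dt_hs: "i \<in> {1..n} \<Longrightarrow> dt i s = - (hs i $$ s)"
  by (simp add: dt_def hs)

lemma g_dt:
  assumes "i \<in> {1..n}"
  shows "(\<Sum>u\<in>{- c i..r + - c i}. g i u * dt i (r - u)) = - (if r = 0 then 1 else 0)"
proof -
  have "(gs i * hs i) $$ r = (\<Sum>u\<in>{- c i..r - c i}. gs i $$ u * hs i $$ (r - u))"
    by (rule fls_mult_nth_bounds) (use assms in \<open>simp_all add: gs_nth g_low hs\<close>)
  then show ?thesis
    using assms by (simp add: hs dt_hs gs_nth sum_negf)
qed

text \<open>The sums for r \<ge> 0, together with empty ones for r < 0, say that g_i times the
  series of \<open>D\<close> is -1; g_i is invertible.\<close>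

lemma dt_unique:
  assumes i: "i \<in> {1..n}" and low: "\<And>s. s < c i \<Longrightarrow> D s = 0"
    and eq: "\<And>r. 0 \<le> r \<Longrightarrow> (\<Sum>u\<in>{- c i..r + - c i}. g i u * D (r - u)) = - (if r = 0 then 1 else 0)"
  shows "D = dt i"
proof
  fix s
  have D: "Abs_fls D $$ s = D s" for s
    by (rule Abs_fls_nth_bound[OF low])
  have "gs i * Abs_fls D = - 1"
  proof (rule fls_eqI)
    fix r
    have "(gs i * Abs_fls D) $$ r = (\<Sum>u\<in>{- c i..r - c i}. gs i $$ u * Abs_fls D $$ (r - u))"
      by (rule fls_mult_nth_bounds) (use i in \<open>simp_all add: gs_nth g_low D low\<close>)
    also have "\<dots> = - (if r = 0 then 1 else 0)"
      using eq[of r] i by (cases "r < 0") (simp_all add: gs_nth D)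
    finally show "(gs i * Abs_fls D) $$ r = (- 1) $$ r"
      by simp
  qed
  then have "(hs i * gs i) * Abs_fls D = - hs i"
    by (simp only: mult.assoc mult_minus_right mult_1_right)
  then have "Abs_fls D = - hs i"
    using i by (simp add: hs)
  then show "D s = dt i s"
    using D[of s] i by (simp add: dt_hs)
qed

lemma Y1:
  assumes i: "i \<in> {1..<n}" and j: "j \<in> {1..<n}" and rs: "r \<ge> 1" "s \<ge> 1"
  shows "comm (e i (i + 1) r) (f (j + 1) j s) =
    - (kd i j * (\<Sum>u\<in>{c i..r + s - 1 + c (i + 1)}. dt i u * g (i + 1) (r + s - u - 1)))"
proof -
  interpret o: gauss_rtt n c "\<lambda>i j r. Op (t j i r)" "\<lambda>i j r. Op (f j i r)" "\<lambda>i j r. Op (e j i r)"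
    "\<lambda>i r. Op (g i r)"
    by unfold_locales (rule op)
  consider "i < j" | "i = j" | "j < i" by linarith
  then show ?thesis
  proof cases
    case 1
    then show ?thesis using Y1_off[of i j r s] i j by (simp add: kd_def)
  next
    case 2
    have "(hs i * gs (i + 1)) $$ (r + s - 1) =
        (\<Sum>u\<in>{c i..r + s - 1 - - c (i + 1)}. hs i $$ u * gs (i + 1) $$ (r + s - 1 - u))"
      by (rule fls_mult_nth_bounds) (use i in \<open>simp_all add: gs_nth g_low hs\<close>)
    also have "\<dots> = (\<Sum>u\<in>{c i..r + s - 1 + c (i + 1)}. hs i $$ u * g (i + 1) (r + s - u - 1))"
      using i by (intro sum.cong) (simp_all add: gs_nth algebra_simps)
    finally show ?thesis
      using Y1_diag[of i r s] i rs 2 by (simp add: kd_def dt_hs sum_negf)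
  next
    case 3
    \<comment> \<open>In the opposite ring f takes the part of e, so the case i < j applies with the
      indices exchanged.\<close>
    have "comm (Op (f (j + 1) j s)) (Op (e i (i + 1) r)) = 0"
      using o.Y1_off[of j i s r] 3 i j by simp
    then show ?thesis
      using 3 by (simp add: comm_Op Op_simps kd_def)
  qed
qed

lemma Y_relations: "Y_rels n (\<lambda>i. - c i) (\<lambda>i. e i (i+1)) (\<lambda>i. f (i+1) i) g dt"
proof -
  interpret o: gauss_rtt n c "\<lambda>i j r. Op (t j i r)" "\<lambda>i j r. Op (f j i r)" "\<lambda>i j r. Op (e j i r)"
    "\<lambda>i r. Op (g i r)"
    by unfold_locales (rule op)
  note op_defs = comm_Op Op_simps Op_sum[symmetric] kd_Op op.inject
  have Y3: "comm (g i r) (f (j + 1) j s) = (kd i j - kd i (j + 1)) *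
      (\<Sum>u\<in>{- c i..r - 1}. f (j + 1) j (r + s - u - 1) * g i u)"
    if "i \<in> {1..n}" "j \<in> {1..<n}" "r \<ge> - c i" "s \<ge> 1" for i j r s
    using o.Y2[OF that] unfolding op_defs comm_swap[of "g i r"]
    by (auto simp: kd_def)
  have Y5: "comm (f (i + 1) i r) (f (i + 1) i s) =
      (\<Sum>u\<in>{1..s - 1}. f (i + 1) i (r + s - u - 1) * f (i + 1) i u) -
      (\<Sum>u\<in>{1..r - 1}. f (i + 1) i (r + s - u - 1) * f (i + 1) i u)"
    if "i \<in> {1..<n}" "r \<ge> 1" "s \<ge> 1" for i r s
    unfolding comm_swap[of "f (i + 1) i r"]
    using o.Y4[OF that] unfolding op_defs by (simp only: minus_diff_eq)
  have Y7: "comm (f (i + 1) i (r + 1)) (f (i + 1 + 1) (i + 1) s) -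
      comm (f (i + 1) i r) (f (i + 1 + 1) (i + 1) (s + 1)) = f (i + 1 + 1) (i + 1) s * f (i + 1) i r"
    if "1 \<le> i" "i + 1 < n" "r \<ge> 1" "s \<ge> 1" for i r s
    unfolding comm_swap[of "f (i + 1) i _"]
    using o.Y6[OF that] unfolding op_defs by (simp add: algebra_simps)
  have Y8': "comm (e i (i + 1) r) (e j (j + 1) s) = 0" "comm (f (i + 1) i r) (f (j + 1) j s) = 0"
    if "i \<in> {1..<n}" "j \<in> {1..<n}" "i + 1 < j \<or> j + 1 < i" for i j r s
  proof -
    show "comm (e i (i + 1) r) (e j (j + 1) s) = 0"
      using that Y8[of i j r s] Y8[of j i s r] by (auto simp: comm_swap[of "e i _ _"])
    show "comm (f (i + 1) i r) (f (j + 1) j s) = 0"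
      using that o.Y8[of i j r s, unfolded op_defs] o.Y8[of j i s r, unfolded op_defs]
      by (auto simp: comm_swap[of "f (Suc i) i r"])
  qed
  have Y11: "serre (f (i + 1) i r) (f (i + 1) i s) (f (j + 1) j u) = 0"
    if "i \<in> {1..<n}" "j \<in> {1..<n}" "i + 1 = j \<or> j + 1 = i" "r \<ge> 1" "s \<ge> 1" "u \<ge> 1" for i j r s u
    using o.Y10[OF that] unfolding serre_Op op_defs .
  show ?thesis
    unfolding Y_rels_def minus_minus diff_minus_eq_add
  proof (intro conjI ballI allI impI)
    fix i r assume "i \<in> {1..n}" "(0::int) \<le> r"
    then show "(\<Sum>u\<in>{- c i..r + - c i}. g i u * dt i (r - u)) = - (if r = 0 then 1 else 0)"
      by (intro g_dt)
  next
    fix i j and r s :: int assume "i \<in> {1..<n}" "j \<in> {1..<n}" "i + 1 < j \<or> j + 1 < i"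
    then show "comm (e i (i + 1) r) (e j (j + 1) s) = 0" "comm (f (i + 1) i r) (f (j + 1) j s) = 0"
      by (rule Y8')+
  next
    fix i j and r s u :: int
    assume "i \<in> {1..<n}" "j \<in> {1..<n}" "i + 1 = j \<or> j + 1 = i" "1 \<le> r" "1 \<le> s" "1 \<le> u"
    note * = this
    show "comm (e i (i + 1) r) (comm (e i (i + 1) s) (e j (j + 1) u)) +
        comm (e i (i + 1) s) (comm (e i (i + 1) r) (e j (j + 1) u)) = 0"
      by (rule Y10[OF *, unfolded serre_def])
    show "comm (f (i + 1) i r) (comm (f (i + 1) i s) (f (j + 1) j u)) +
        comm (f (i + 1) i s) (comm (f (i + 1) i r) (f (j + 1) j u)) = 0"
      by (rule Y11[OF *, unfolded serre_def])
  qed (rule g_lead g_comm Y1 Y2 Y3 Y4 Y5 Y6 Y7; assumption)+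
qed

text \<open>Coordinates further off the diagonal are commutators with a coefficient of superscript
  1, so induction on j - i - 1 reaches all e and f; the entries of T are finite Gauss sums.\<close>

lemma generated:
  assumes phi: "C_algebra_struct phi"
    and gen: "\<And>i r. i \<in> {1..<n} \<Longrightarrow> r \<ge> 1 \<Longrightarrow> e i (i + 1) r \<in> S"
      "\<And>i r. i \<in> {1..<n} \<Longrightarrow> r \<ge> 1 \<Longrightarrow> f (i + 1) i r \<in> S"
      "\<And>i r. i \<in> {1..n} \<Longrightarrow> r \<ge> - c i \<Longrightarrow> g i r \<in> S"
  shows "1 \<le> i \<Longrightarrow> i < j \<Longrightarrow> j \<le> n \<Longrightarrow> r \<ge> 1 \<Longrightarrow> e i j r \<in> C_subalg phi S"
    "1 \<le> i \<Longrightarrow> i < j \<Longrightarrow> j \<le> n \<Longrightarrow> r \<ge> 1 \<Longrightarrow> f j i r \<in> C_subalg phi S"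
    "i \<in> {1..n} \<Longrightarrow> g i r \<in> C_subalg phi S"
    "i \<in> {1..n} \<Longrightarrow> j \<in> {1..n} \<Longrightarrow> t i j r \<in> C_subalg phi S"
proof -
  interpret o: gauss_rtt n c "\<lambda>i j r. Op (t j i r)" "\<lambda>i j r. Op (f j i r)" "\<lambda>i j r. Op (e j i r)"
    "\<lambda>i r. Op (g i r)"
    by unfold_locales (rule op)
  note closed = C_subalg_closed[OF phi]
  have "e i (i + 1 + k) r \<in> C_subalg phi S \<and> f (i + 1 + k) i r \<in> C_subalg phi S"
    if "1 \<le> i" "i + 1 + k \<le> n" "r \<ge> 1" for i k r
    using that
  proof (induction k arbitrary: i r)
    case 0
    then show ?case using gen(1,2)[of i r] by (auto intro: C_subalg.gen)
  next
    case (Suc k)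
    have e1: "e i (i + 1) r \<in> C_subalg phi S" and f1: "f (i + 1) i r \<in> C_subalg phi S"
      using Suc.prems gen(1,2)[of i r] by (auto intro: C_subalg.gen)
    have IH: "e (i + 1) (i + 1 + Suc k) 1 \<in> C_subalg phi S" "f (i + 1 + Suc k) (i + 1) 1 \<in> C_subalg phi S"
      using Suc.IH[of "i + 1" 1] Suc.prems by simp_all
    have l: "i + 1 + Suc k \<in> {i + 1<..n}" using Suc.prems by auto
    have f: "f (i + 1 + Suc k) i r = - comm (f (i + 1 + Suc k) (i + 1) 1) (f (i + 1) i r)"
      using o.e_gen[OF Suc.prems(1) l Suc.prems(3)] unfolding comm_Op Op_simps op.inject .
    show ?case
      unfolding f e_gen[OF Suc.prems(1) l Suc.prems(3)]
      by (intro conjI closed(3,4) e1 f1 IH)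
  qed
  note ef = this
  have E: "e i j r \<in> C_subalg phi S" and F: "f j i r \<in> C_subalg phi S"
    if "1 \<le> i" "i < j" "j \<le> n" "r \<ge> 1" for i j r
    using ef[of i "j - i - 1" r] that by simp_all
  show "e i j r \<in> C_subalg phi S" "f j i r \<in> C_subalg phi S"
    if "1 \<le> i" "i < j" "j \<le> n" "r \<ge> 1"
    using E F that by blast+
  have G: "g i r \<in> C_subalg phi S" if "i \<in> {1..n}" for i r
    using gen(3)[of i r] g_low[of i r] that closed(1)
    by (cases "r < - c i") (auto intro: C_subalg.gen)
  then show "i \<in> {1..n} \<Longrightarrow> g i r \<in> C_subalg phi S" .
  have gF: "gauss_F f i k a \<in> C_subalg phi S" if "k \<in> {1..i}" "i \<le> n" for i k a
    using that F[of k i a] f_low[of k i a] closed(1,2)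
    by (cases "a \<le> 0") (auto simp: gauss_F_def)
  have gE: "gauss_E e k j a \<in> C_subalg phi S" if "k \<in> {1..j}" "j \<le> n" for j k a
    using that E[of k j a] e_low[of k j a] closed(1,2)
    by (cases "a \<le> 0") (auto simp: gauss_E_def)
  show "t i j r \<in> C_subalg phi S" if "i \<in> {1..n}" "j \<in> {1..n}"
    unfolding t_eq[OF that]
    by (intro closed(5) C_subalg.mult gF gE G) (use that in auto)
qed

end

text \<open>The elements live in an arbitrary complex algebra, so a map out of the Drinfeld side
  exists when its values satisfy the Drinfeld relations. Only the images of the D tilde are not
  prescribed, and their uniqueness is that of the map; values outside the index ranges are
  normalised to 0. Surjectivity is membership in the subalgebra generated by the images.\<close>

theorem theorem2p18:
  fixes n :: nat and c :: "nat \<Rightarrow> int"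
    and phi :: "complex \<Rightarrow> 'a::ring_1"
    and t e f :: "nat \<Rightarrow> nat \<Rightarrow> int \<Rightarrow> 'a" and g :: "nat \<Rightarrow> int \<Rightarrow> 'a"
  assumes "n \<ge> 2"
    and dominant: "\<forall>i\<in>{1..<n}. c i \<ge> c (i+1)"
    and "C_algebra_struct phi"
    and "RTT_rels n c t e f g"
  shows "(\<exists>!Dt. (\<forall>i s. (i \<notin> {1..n} \<or> s < c i) \<longrightarrow> Dt i s = 0) \<and>
            Y_rels n (\<lambda>i. - c i) (\<lambda>i. e i (i+1)) (\<lambda>i. f (i+1) i) g Dt) \<and>
         (\<forall>Dt. Y_rels n (\<lambda>i. - c i) (\<lambda>i. e i (i+1)) (\<lambda>i. f (i+1) i) g Dt \<longrightarrow>
            (let S = {e i (i+1) r | i r. i \<in> {1..<n} \<and> r \<ge> 1}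
                   \<union> {f (i+1) i r | i r. i \<in> {1..<n} \<and> r \<ge> 1}
                   \<union> {g i r | i r. i \<in> {1..n} \<and> r \<ge> - c i}
                   \<union> {Dt i r | i r. i \<in> {1..n} \<and> r \<ge> c i}
             in (\<forall>i\<in>{1..n}. \<forall>j\<in>{1..n}. \<forall>r. t i j r \<in> C_subalg phi S) \<and>
                (\<forall>i j r. 1 \<le> i \<longrightarrow> i < j \<longrightarrow> j \<le> n \<longrightarrow> r \<ge> 1 \<longrightarrow>
                    e i j r \<in> C_subalg phi S \<and> f j i r \<in> C_subalg phi S) \<and>
                (\<forall>i\<in>{1..n}. \<forall>r. g i r \<in> C_subalg phi S)))"
proof -
  interpret gauss_rtt n c t e f g
    by unfold_locales fact
  have "\<exists>!Dt. (\<forall>i s. (i \<notin> {1..n} \<or> s < c i) \<longrightarrow> Dt i s = 0) \<and>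
      Y_rels n (\<lambda>i. - c i) (\<lambda>i. e i (i+1)) (\<lambda>i. f (i+1) i) g Dt"
  proof (rule ex1I[of _ dt])
    show "(\<forall>i s. (i \<notin> {1..n} \<or> s < c i) \<longrightarrow> dt i s = 0) \<and>
        Y_rels n (\<lambda>i. - c i) (\<lambda>i. e i (i+1)) (\<lambda>i. f (i+1) i) g dt"
      by (intro conjI allI impI Y_relations) (auto simp: dt_def)
  next
    fix Dt
    assume Dt: "(\<forall>i s. (i \<notin> {1..n} \<or> s < c i) \<longrightarrow> Dt i s = 0) \<and>
      Y_rels n (\<lambda>i. - c i) (\<lambda>i. e i (i+1)) (\<lambda>i. f (i+1) i) g Dt"
    then have low: "Dt i s = 0" if "i \<notin> {1..n} \<or> s < c i" for i s
      using that by simp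
    \<comment> \<open>This selects the second conjunct of \<open>Y_rels\<close>, the relation that
      determines the D tilde.\<close>
    have Y0: "\<forall>i\<in>{1..n}. \<forall>r::int. r \<ge> 0 \<longrightarrow>
        (\<Sum>u\<in>{- c i..r + - c i}. g i u * Dt i (r - u)) = - (if r = 0 then 1 else 0)"
      by (rule conjunct1[OF conjunct2[OF conjunct2[OF Dt, unfolded Y_rels_def]]])
    show "Dt = dt"
    proof
      fix i
      show "Dt i = dt i"
      proof (cases "i \<in> {1..n}")
        case True
        show ?thesis
        proof (rule dt_unique[OF True])
          show "Dt i s = 0" if "s < c i" for s
            using low that by simp
          show "(\<Sum>u\<in>{- c i..r + - c i}. g i u * Dt i (r - u)) = - (if r = 0 then 1 else 0)"
            if "0 \<le> r" for r
            using Y0 True that by blast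
        qed
      next
        case False
        then show ?thesis
          using low[of i] by (intro ext) (auto simp: dt_def)
      qed
    qed
  qed
  moreover have *: "(\<forall>i\<in>{1..n}. \<forall>j\<in>{1..n}. \<forall>r. t i j r \<in> C_subalg phi S) \<and>
      (\<forall>i j r. 1 \<le> i \<longrightarrow> i < j \<longrightarrow> j \<le> n \<longrightarrow> r \<ge> 1 \<longrightarrow>
          e i j r \<in> C_subalg phi S \<and> f j i r \<in> C_subalg phi S) \<and>
      (\<forall>i\<in>{1..n}. \<forall>r. g i r \<in> C_subalg phi S)"
    if S: "S = {e i (i+1) r | i r. i \<in> {1..<n} \<and> r \<ge> 1}
         \<union> {f (i+1) i r | i r. i \<in> {1..<n} \<and> r \<ge> 1}
         \<union> {g i r | i r. i \<in> {1..n} \<and> r \<ge> - c i} \<union> R" for S R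
  proof -
    have gen: "\<And>i r. i \<in> {1..<n} \<Longrightarrow> r \<ge> 1 \<Longrightarrow> e i (i + 1) r \<in> S"
      "\<And>i r. i \<in> {1..<n} \<Longrightarrow> r \<ge> 1 \<Longrightarrow> f (i + 1) i r \<in> S"
      "\<And>i r. i \<in> {1..n} \<Longrightarrow> r \<ge> - c i \<Longrightarrow> g i r \<in> S"
      unfolding S by blast+
    note G = generated[OF assms(3) gen]
    show ?thesis
      by (intro conjI ballI allI impI) (rule G; assumption)+
  qed
  ultimately show ?thesis
    unfolding Let_def by (intro conjI[OF _ allI[OF impI]] *[OF refl])
qed

end
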